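(* Let $Z=(Z^+,Z^-)$ be the Filippov vector field given by $Z^+=(X^+,Y^+)$ for $y>0$ and $Z^-=(X^-,Y^-)$ for $y<0$, with $Z^\pm$ analytic near the origin of $\mathbb{R}^2$, and assume that $Z$ has a $(2k^+,2k^-)$-monodromic tangential singularity at the origin, for positive integers $k^+$ and $k^-$. Let $\delta=\mathrm{sign}(X^+(0,0))$ and let $a^{\pm}$, $f^{\pm}(x)=\sum_{i\ge0}f_i^{\pm}x^i$ and $g^{\pm}(x,y)=\sum_{i,j\ge0}g_{i,j}^{\pm}x^iy^j$ be the number and the analytic functions associated with $Z^{\pm}$ defined in the context. Then the first four coefficients of the power series $\varphi^{\pm}(x)=\sum_{n\ge1}\alpha_n^{\pm}x^n$ of the half-return maps are given as follows, where on the right-hand sides $a,k,f_i,g_{i,j}$ stand for $a^{\pm},k^{\pm},f_i^{\pm},g_{i,j}^{\pm}$: $$\alpha_1^{\pm}=-1,\qquad \alpha_2^{\pm}=\frac{-2f_0\pm2\delta a g_{0,0}}{2ak+a},\qquad \alpha_3^{\pm}=-(\alpha_2^{\pm})^2,$$ $$\begin{aligned}\alpha_4^{\pm}=&\ \frac{4(k(2k+3)+7)(-f_0\pm\delta a g_{0,0})^3}{3a^3(2k+1)^3}\mp\frac{12\delta a(f_0\mp\delta a g_{0,0})\left(a(g_{1,0}\mp\delta g_{0,0}^2)+2f_0g_{0,0}\mp2\delta f_1\right)}{3a^3(8k+4)}\\&\pm\frac{4\delta a^2\left(a(2g_{2,0}+g_{0,0}^3)+6g_{0,0}f_1+3f_0g_{1,0}\mp3\delta(a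 g_{1,0}g_{0,0}+f_0g_{0,0}^2+2f_2)\right)}{3a^3(8k+12)}+\xi_k,\end{aligned}$$ where $\xi_1=-\frac{4a g_{0,1}}{15}$ and $\xi_k=0$ for $k>1$.
   Context: All formulas with $\pm$ are two separate statements, one with all upper signs and one with all lower signs. The origin is a $(2k^+,2k^-)$-monodromic tangential singularity of $Z$ (discontinuity line $\Sigma=\{y=0\}$) when it is an invisible contact of multiplicity $2k^{+}$ of $Z^+$ with $\Sigma$, an invisible contact of multiplicity $2k^-$ of $Z^-$ with $\Sigma$, and a first-return map on $\Sigma$ is defined around it; concretely: C1. $X^{\pm}(0,0)\neq0$, $Y^{\pm}(0,0)=0$, $\frac{\partial^i Y^{\pm}}{\partial x^i}(0,0)=0$ for $i=1,\ldots,2k^{\pm}-2$, and $\frac{\partial^{2k^{\pm}-1} Y^{\pm}}{\partial x^{2k^{\pm}-1}}(0,0)\neq0$; C2. $X^+(0,0)\frac{\partial^{2k^{+}-1} Y^{+}}{\partial x^{2k^{+}-1}}(0,0)<0$ and $X^-(0,0)\frac{\partial^{2k^{-}-1} Y^{-}}{\partial x^{2k^{-}-1}}(0,0)>0$; C3. $X^+(0,0)X^-(0,0)<0$. Thus $\delta=\mathrm{sign}(X^+(0,0))=-\mathrm{sign}(X^-(0,0))$. Half-return maps: for $x\neq 0$ close to $0$, the orbit of $Z^{+}$ through $(x,0)$ restricted to $\{y\ge 0\}$ (resp. of $Z^-$ restricted to $\{y\le0\}$), followed forward or backward in time (whichever direction enters $\{y>0\}$, resp. $\{y<0\}$), meets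 $\Sigma$ again for the first time at $(\varphi^{+}(x),0)$ (resp. $(\varphi^{-}(x),0)$); $\varphi^{\pm}(0)=0$. The maps $\varphi^{\pm}$ are analytic involutions near $0$. Definitions of $a^{\pm},f^{\pm},g^{\pm}$: $$a^{\pm}=\frac{1}{(2k^{\pm}-1)!\,|X^{\pm}(0,0)|}\frac{\partial^{2k^{\pm}-1}Y^{\pm}}{\partial x^{2k^{\pm}-1}}(0,0),$$ $$f^{\pm}(x)=\frac{\pm \delta Y^{\pm}(x,0)-a^{\pm}x^{2k^{\pm}-1} X^{\pm}(x,0)}{x^{2k^{\pm}} X^{\pm}(x,0)},\qquad g^{\pm}(x,y)=\frac{\pm X^{\pm}(x,0)Y^{\pm}(x,y) \mp X^{\pm}(x,y)Y^{\pm}(x,0)}{y\, \delta X^{\pm}(x,y)X^{\pm}(x,0)}$$ (analytic near the origin after extension across removable singularities). Equivalently, $\pm\delta\,Y^{\pm}/X^{\pm}=a^{\pm}x^{2k^{\pm}-1}+x^{2k^{\pm}}f^{\pm}(x)+y\,g^{\pm}(x,y)$. *)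

theory Defs
  imports "HOL-Analysis.Analysis"
begin

section \<open>Real-analytic functions of two variables\<close>

text \<open>Absolute convergence on a box; for real terms \<open>has_sum\<close> is unconditional, hence absolute,
  convergence of the double series.\<close>

definition has_power_series2 ::
    "(real \<times> real \<Rightarrow> real) \<Rightarrow> real \<times> real \<Rightarrow> (nat \<Rightarrow> nat \<Rightarrow> real) \<Rightarrow> bool" where
  "has_power_series2 h p c \<longleftrightarrow>
     (\<exists>r>0. \<forall>u v. \<bar>u\<bar> < r \<longrightarrow> \<bar>v\<bar> < r \<longrightarrow>
        ((\<lambda>(i, j). c i j * u ^ i * v ^ j) has_sum h (fst p + u, snd p + v)) UNIV)"

definition analytic2_near :: "(real \<times> real \<Rightarrow> real) \<Rightarrow> real \<times> real \<Rightarrow> bool" where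
  "analytic2_near h p \<longleftrightarrow> (\<forall>\<^sub>F q in nhds p. \<exists>c. has_power_series2 h q c)"

section \<open>Piecewise vector fields\<close>

text \<open>The discontinuity line is \<open>y = 0\<close>; \<open>Z Upper\<close> and \<open>Z Lower\<close> are the fields
  \<open>Z\<^sup>+\<close> and \<open>Z\<^sup>-\<close>. A formula with the sign \<open>\<plusminus>\<close> is rendered with \<open>pm s\<close>, and \<open>\<minusplus>\<close> with \<open>- pm s\<close>,
  for an arbitrary side \<open>s\<close>. Vector fields are total functions, but only their values near the
  origin are constrained.\<close>

datatype side = Upper | Lower

fun pm :: "side \<Rightarrow> real" where
  "pm Upper = 1"
| "pm Lower = -1"

type_synonym vfield = "real \<times> real \<Rightarrow> real \<times> real"

definition X_of :: "vfield \<Rightarrow> real \<Rightarrow> real \<Rightarrow> real" where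
  "X_of V x y = fst (V (x, y))"

definition Y_of :: "vfield \<Rightarrow> real \<Rightarrow> real \<Rightarrow> real" where
  "Y_of V x y = snd (V (x, y))"

definition analytic_field :: "vfield \<Rightarrow> bool" where
  "analytic_field V \<longleftrightarrow>
     analytic2_near (\<lambda>p. fst (V p)) (0, 0) \<and> analytic2_near (\<lambda>p. snd (V p)) (0, 0)"

text \<open>\<open>dxY V i\<close> is the \<open>i\<close>-th partial derivative of \<open>Y\<close> with respect to \<open>x\<close> at the origin.\<close>

definition dxY :: "vfield \<Rightarrow> nat \<Rightarrow> real" where
  "dxY V i = (deriv ^^ i) (\<lambda>x. Y_of V x 0) 0"

section \<open>Monodromic tangential singularities\<close>

text \<open>The origin is a \<open>(2 k\<^sup>+, 2 k\<^sup>-)\<close>-monodromic tangential singularity.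
  Since \<open>pm s\<close> is nonzero, the second conjunct states that \<open>X \<cdot> \<partial>\<^sub>x Y\<close> (of order
  \<open>2 k - 1\<close>) is negative for the upper and positive for the lower field.\<close>

definition monodromic_tangential :: "(side \<Rightarrow> vfield) \<Rightarrow> (side \<Rightarrow> nat) \<Rightarrow> bool" where
  "monodromic_tangential Z k \<longleftrightarrow>
     (\<forall>s. X_of (Z s) 0 0 \<noteq> 0 \<and> Y_of (Z s) 0 0 = 0 \<and>
          (\<forall>i\<in>{1..2 * k s - 2}. dxY (Z s) i = 0) \<and> dxY (Z s) (2 * k s - 1) \<noteq> 0) \<and>
     (\<forall>s. pm s * (X_of (Z s) 0 0 * dxY (Z s) (2 * k s - 1)) < 0) \<and>
     X_of (Z Upper) 0 0 * X_of (Z Lower) 0 0 < 0"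

section \<open>Half-return maps\<close>

text \<open>A negative \<open>T\<close> means that the orbit is followed backward in time. As the open arc lies
  strictly on the side \<open>s\<close>, the point \<open>(x', 0)\<close> is the first return to the discontinuity line.\<close>

definition half_return_point :: "side \<Rightarrow> vfield \<Rightarrow> real \<Rightarrow> real \<Rightarrow> bool" where
  "half_return_point s V x x' \<longleftrightarrow>
     (\<exists>T \<gamma>. T \<noteq> 0 \<and> \<gamma> 0 = (x, 0) \<and> \<gamma> T = (x', 0) \<and>
        (\<forall>t\<in>closed_segment 0 T.
           (\<gamma> has_vector_derivative V (\<gamma> t)) (at t within closed_segment 0 T)) \<and>
        (\<forall>t\<in>open_segment 0 T. pm s * snd (\<gamma> t) > 0))"

definition half_return_map :: "side \<Rightarrow> vfield \<Rightarrow> (real \<Rightarrow> real) \<Rightarrow> bool" where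
  "half_return_map s V \<phi> \<longleftrightarrow>
     \<phi> 0 = 0 \<and> (\<forall>\<^sub>F x in at 0. half_return_point s V x (\<phi> x))"

section \<open>The data \<open>a\<close>, \<open>f\<close> and \<open>g\<close>\<close>

definition a_of :: "vfield \<Rightarrow> nat \<Rightarrow> real" where
  "a_of V k = dxY V (2 * k - 1) / (fact (2 * k - 1) * \<bar>X_of V 0 0\<bar>)"

text \<open>The quotients defining \<open>f\<close> and \<open>g\<close> away from their removable singularities \<open>x = 0\<close> and
  \<open>y = 0\<close>, respectively.\<close>

definition f_quot :: "side \<Rightarrow> real \<Rightarrow> vfield \<Rightarrow> nat \<Rightarrow> real \<Rightarrow> real" where
  "f_quot s \<delta> V k x =
     (pm s * \<delta> * Y_of V x 0 - a_of V k * x ^ (2 * k - 1) * X_of V x 0) /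
     (x ^ (2 * k) * X_of V x 0)"

definition g_quot :: "side \<Rightarrow> real \<Rightarrow> vfield \<Rightarrow> real \<Rightarrow> real \<Rightarrow> real" where
  "g_quot s \<delta> V x y =
     (pm s * X_of V x 0 * Y_of V x y - pm s * X_of V x y * Y_of V x 0) /
     (y * \<delta> * X_of V x y * X_of V x 0)"

text \<open>The analytic extension of \<open>f\<close> (resp. \<open>g\<close>) across its singularity has the given
  Taylor coefficients at the origin.\<close>

definition f_expansion :: "side \<Rightarrow> real \<Rightarrow> vfield \<Rightarrow> nat \<Rightarrow> real fps \<Rightarrow> bool" where
  "f_expansion s \<delta> V k F \<longleftrightarrow>
     (\<exists>f. (\<forall>\<^sub>F x in at 0. f x = f_quot s \<delta> V k x) \<and> f has_fps_expansion F)"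

definition g_expansion :: "side \<Rightarrow> real \<Rightarrow> vfield \<Rightarrow> (nat \<Rightarrow> nat \<Rightarrow> real) \<Rightarrow> bool" where
  "g_expansion s \<delta> V G \<longleftrightarrow>
     (\<exists>g. (\<forall>\<^sub>F (x, y) in nhds (0, 0). y \<noteq> 0 \<longrightarrow> g (x, y) = g_quot s \<delta> V x y) \<and>
          has_power_series2 g (0, 0) G)"

end

theory Submission
  imports Defs
begin

text \<open>Near the origin the orbits are graphs of solutions of
  \<open>\<plusminus>\<delta> dy/dx = a x^(2k-1) + x^(2k) f(x) + y g(x,y)\<close>. A Gronwall estimate for
  \<open>\<bar>y\<bar> + \<bar>a\<bar> x^(2k) / (2k)\<close> shows that the arc starting at \<open>(x\<^sub>0, 0)\<close> satisfies
  \<open>x = O(x\<^sub>0)\<close> and \<open>y = O(x\<^sub>0^(2k))\<close>; in particular it stays near the origin, and by the sign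
  of the slope on the line it goes from \<open>x\<^sub>0 > 0\<close> to \<open>\<phi>(x\<^sub>0) \<le> 0\<close>. Multiplying by the integrating
  factor of the part linear in \<open>y\<close> and integrating along the arc gives
  \<open>P(\<phi>(x\<^sub>0)) = P(x\<^sub>0) + O(x\<^sub>0^(2k+4))\<close> with an explicit polynomial \<open>P\<close>, up to the contribution of
  the term in \<open>y\<^sup>2\<close>, which has order \<open>4k+1\<close> and therefore matters only for \<open>k = 1\<close>. Comparing the
  coefficients of orders \<open>2k\<close> to \<open>2k+3\<close> determines \<open>\<alpha>\<^sub>1\<close> to \<open>\<alpha>\<^sub>4\<close>. Only positive \<open>x\<^sub>0\<close> are needed.\<close>

section \<open>Remainders of power series\<close>

text \<open>With the height p = \<open>pm s * y\<close> both sides become one problem, dp/dx = -q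
  x^(2k-1) + x^(2k) F(x) + p G(x,p), where q = -\<delta> a is positive on either side because the
  contact is invisible. The signs are restored only at the very end. The obstacle is that a return
  arc is merely given: its time direction is open, and it is a graph over the x axis only where the
  field is controlled. So it has to be confined before anything can be integrated along it. The
  integrating factor pays off because the height vanishes at both ends: the boundary term drops out,
  and what remains relates the end points alone. Errors are counted in powers of the starting
  abscissa, x having weight 1 and y weight 2k. Since 2k is at least 2, only F up to degree 2, the
  terms 1, x, x^2 of G and its term in y can reach the orders in question.\<close>

lemma has_fps_expansion_remainder:
  fixes f :: "real \<Rightarrow> real"
  assumes "f has_fps_expansion F"
  obtains M where "M \<ge> 0"
    "\<forall>\<^sub>F x in nhds 0. \<bar>f x - (\<Sum>i<n. fps_nth F i * x ^ i)\<bar> \<le> M * \<bar>x\<bar> ^ n"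
proof -
  \<comment> \<open>The tail is X^n times the shifted series, which again has positive radius of
    convergence. Its evaluation is continuous at 0, hence bounded nearby.\<close>
  define R where "R = fps_shift n F"
  define P where "P = (\<Sum>i<n. fps_const (fps_nth F i) * fps_X ^ i)"
  have "fps_nth F j = fps_nth (P + R * fps_X ^ n) j" for j
  proof -
    have "fps_nth P j = (if j < n then fps_nth F j else 0)"
      by (simp add: P_def fps_sum_nth if_distrib sum.delta cong: if_cong)
    then show ?thesis
      by (simp add: R_def fps_X_power_mult_right_nth)
  qed
  then have "F = P + R * fps_X ^ n"
    by (simp add: fps_eq_iff)
  moreover have rad: "fps_conv_radius R > 0"
    using assms by (simp add: R_def has_fps_expansion_def)
  moreover have "(\<lambda>x. \<Sum>i<n. fps_nth F i * x ^ i) has_fps_expansion P"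
    unfolding P_def by (intro fps_expansion_intros)
  ultimately have "(\<lambda>x. (\<Sum>i<n. fps_nth F i * x ^ i) + eval_fps R x * x ^ n) has_fps_expansion F"
    using has_fps_expansion_add[OF _ has_fps_expansion_mult[OF eval_fps_has_fps_expansion
        has_fps_expansion_fps_X_power]] by simp
  with assms have eq: "\<forall>\<^sub>F x in nhds 0. f x = (\<Sum>i<n. fps_nth F i * x ^ i) + eval_fps R x * x ^ n"
    unfolding has_fps_expansion_def by (auto elim: eventually_elim2)
  have "isCont (eval_fps R) 0"
    by (rule continuous_eval_fps) (use rad in \<open>auto simp: zero_ereal_def\<close>)
  then have "(eval_fps R \<longlongrightarrow> eval_fps R 0) (nhds 0)"
    using tendsto_at_iff_tendsto_nhds continuous_at by blast
  then have "\<forall>\<^sub>F x in nhds 0. \<bar>eval_fps R x\<bar> < \<bar>eval_fps R 0\<bar> + 1"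
    by (intro order_tendstoD(2)[OF tendsto_rabs]) auto
  with eq have "\<forall>\<^sub>F x in nhds 0. \<bar>f x - (\<Sum>i<n. fps_nth F i * x ^ i)\<bar>
      \<le> (\<bar>eval_fps R 0\<bar> + 1) * \<bar>x\<bar> ^ n"
    by eventually_elim (auto simp: abs_mult power_abs intro!: mult_right_mono)
  then show ?thesis
    by (intro that[of "\<bar>eval_fps R 0\<bar> + 1"]) auto
qed

text \<open>Once the coefficients below \<open>m\<close> vanish, the remainder estimate isolates the
  term of order \<open>m\<close>; division by \<open>x ^ m\<close> and a limit from the right kill
  it. This turns an estimate for arcs with positive start into an identity of power series.\<close>

lemma fps_nth_eq_0_if_bounded:
  fixes h :: "real \<Rightarrow> real"
  assumes "h has_fps_expansion H"
    and "\<forall>\<^sub>F x in at_right 0. \<bar>h x\<bar> \<le> C * x ^ n"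
    and "m < n"
  shows "fps_nth H m = 0"
  using assms(3)
proof (induction m rule: less_induct)
  case (less m)
  obtain M where M: "M \<ge> 0"
    "\<forall>\<^sub>F x in nhds 0. \<bar>h x - (\<Sum>i<Suc m. fps_nth H i * x ^ i)\<bar> \<le> M * \<bar>x\<bar> ^ Suc m"
    using has_fps_expansion_remainder[OF assms(1)] by metis
  have "(\<Sum>i<Suc m. fps_nth H i * x ^ i) = fps_nth H m * x ^ m" for x
    using less by simp
  with M(2) have "\<forall>\<^sub>F x in at_right 0. \<bar>h x - fps_nth H m * x ^ m\<bar> \<le> M * \<bar>x\<bar> ^ Suc m"
    by (auto simp: at_within_def intro: filter_leD[OF inf_le1])
  moreover have "\<forall>\<^sub>F x in at_right (0::real). 0 < x \<and> x < 1"
    using eventually_at_right_real[of 0 "1::real"] by simp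
  ultimately have "\<forall>\<^sub>F x in at_right 0. \<bar>fps_nth H m\<bar> \<le> (\<bar>C\<bar> + M) * x"
    using assms(2)
  proof eventually_elim
    case (elim x)
    \<comment> \<open>The sign of \<open>C\<close> is not assumed, hence the absolute value; the
      exponent drops because \<open>Suc m \<le> n\<close> and \<open>x < 1\<close>.\<close>
    have "C * x ^ n \<le> \<bar>C\<bar> * x ^ Suc m"
      using elim less.prems by (intro mult_mono power_decreasing) auto
    moreover have "\<bar>fps_nth H m\<bar> * x ^ m = \<bar>fps_nth H m * x ^ m\<bar>"
      using elim by (simp add: abs_mult)
    moreover have "M * \<bar>x\<bar> ^ Suc m = M * x ^ Suc m"
      using elim by simp
    ultimately have "\<bar>fps_nth H m\<bar> * x ^ m \<le> \<bar>C\<bar> * x ^ Suc m + M * x ^ Suc m"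
      using elim by linarith
    then have "\<bar>fps_nth H m\<bar> * x ^ m \<le> ((\<bar>C\<bar> + M) * x) * x ^ m"
      by (simp add: algebra_simps)
    then show ?case
      using elim by (simp add: mult_le_cancel_right)
  qed
  moreover have "((\<lambda>x. (\<bar>C\<bar> + M) * x) \<longlongrightarrow> (\<bar>C\<bar> + M) * 0) (at_right 0)"
    by (intro tendsto_intros)
  ultimately have "\<bar>fps_nth H m\<bar> \<le> 0"
    by (intro tendsto_le[OF trivial_limit_at_right_real _ tendsto_const]) auto
  then show ?case by simp
qed

text \<open>The truncation is weighted: with \<open>v\<close> of the size of
  \<open>u\<^sup>2\<close> or smaller, the three error monomials have order at least three. A pair
  of exponents that is not kept has \<open>i \<ge> 3\<close>, or both entries positive, or
  \<open>j \<ge> 2\<close>, so one of the three dominates it.\<close>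

lemma has_power_series2_remainder:
  assumes "has_power_series2 h (0, 0) c"
  obtains M r where "M \<ge> 0" "r > 0"
    "\<And>u v. \<bar>u\<bar> < r \<Longrightarrow> \<bar>v\<bar> < r \<Longrightarrow>
      \<bar>h (u, v) - (c 0 0 + c 1 0 * u + c 2 0 * u\<^sup>2 + c 0 1 * v)\<bar>
        \<le> M * (\<bar>u\<bar> ^ 3 + \<bar>u\<bar> * \<bar>v\<bar> + v\<^sup>2)"
proof -
  obtain R where R: "R > 0"
    "\<And>u v. \<bar>u\<bar> < R \<Longrightarrow> \<bar>v\<bar> < R \<Longrightarrow> ((\<lambda>(i, j). c i j * u ^ i * v ^ j) has_sum h (u, v)) UNIV"
    using assms by (auto simp: has_power_series2_def)
  \<comment> \<open>Strictly inside the box of convergence the series can be evaluated at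
    \<open>(r, r)\<close>, which gives the summable majorant used below.\<close>
  define r where "r = R / 2"
  have r: "r > 0" "r < R" using R by (auto simp: r_def)
  have "(\<lambda>(i, j). c i j * r ^ i * r ^ j) summable_on UNIV"
    using R(2)[of r r] r by (auto intro: has_sum_imp_summable)
  from summable_on_iff_abs_summable_on_real[THEN iffD1, OF this]
  have "(\<lambda>(i, j). \<bar>c i j\<bar> * r ^ i * r ^ j) summable_on UNIV"
    using r by (simp add: abs_mult case_prod_unfold)
  then obtain S where S: "((\<lambda>(i, j). \<bar>c i j\<bar> * r ^ i * r ^ j) has_sum S) UNIV"
    by (auto simp: summable_on_def)
  have "S \<ge> 0"
    using has_sum_nonneg[OF S] r by force
  define M where "M = S * (1 / r ^ 3 + 1 / r\<^sup>2)"
  have "\<bar>h (u, v) - (c 0 0 + c 1 0 * u + c 2 0 * u\<^sup>2 + c 0 1 * v)\<bar>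
        \<le> M * (\<bar>u\<bar> ^ 3 + \<bar>u\<bar> * \<bar>v\<bar> + v\<^sup>2)"
    if uv: "\<bar>u\<bar> < r" "\<bar>v\<bar> < r" for u v
  proof -
    define L :: "(nat \<times> nat) set" where "L = {(0,0), (1,0), (2,0), (0,1)}"
    \<comment> \<open>The sum of the three error monomials in the scaled variables
      \<open>\<bar>u\<bar> / r\<close> and \<open>\<bar>v\<bar> / r\<close>, which are at most 1. It
      bounds every remaining scaled monomial, so it factors out of the majorant.\<close>
    define E where "E = \<bar>u\<bar> ^ 3 / r ^ 3 + \<bar>u\<bar> * \<bar>v\<bar> / r\<^sup>2 + v\<^sup>2 / r\<^sup>2"
    have E0: "E \<ge> 0" using r by (simp add: E_def)
    let ?t = "\<lambda>(i, j). c i j * u ^ i * v ^ j"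
    have "(?t has_sum h (u, v)) UNIV"
      using R(2) uv r by simp
    moreover have "(?t has_sum (\<Sum>p\<in>L. ?t p)) L"
      by (rule has_sum_finite) (simp add: L_def)
    ultimately have 1: "(?t has_sum (h (u, v) - (\<Sum>p\<in>L. ?t p))) (UNIV - L)"
      by (rule has_sum_Diff) simp
    have sumL: "(\<Sum>p\<in>L. ?t p) = c 0 0 + c 1 0 * u + c 2 0 * u\<^sup>2 + c 0 1 * v"
      by (simp add: L_def)
    have "(\<lambda>(i, j). \<bar>c i j\<bar> * r ^ i * r ^ j) summable_on (UNIV - L)"
      using S by (meson has_sum_imp_summable subset_UNIV summable_on_subset_banach)
    then obtain S' where S': "((\<lambda>(i, j). \<bar>c i j\<bar> * r ^ i * r ^ j) has_sum S') (UNIV - L)"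
      by (auto simp: summable_on_def)
    have "S' \<le> S"
      by (rule has_sum_mono2[OF S' S]) (use r in auto)
    have 2: "((\<lambda>(i, j). \<bar>c i j\<bar> * r ^ i * r ^ j * E) has_sum (S' * E)) (UNIV - L)"
      using has_sum_cmult_left[OF S', of E] by (simp add: case_prod_unfold)
    have "norm (h (u, v) - (\<Sum>p\<in>L. ?t p)) \<le> S' * E"
    proof (rule norm_infsum_le[OF 1 2])
      fix p assume p: "p \<in> UNIV - L"
      obtain i j where ij: "p = (i, j)" by (cases p)
      define U V where "U = \<bar>u\<bar> / r" and "V = \<bar>v\<bar> / r"
      have UV: "0 \<le> U" "U \<le> 1" "0 \<le> V" "V \<le> 1"
        using uv r by (auto simp: U_def V_def)
      have E: "E = U ^ 3 + U * V + V ^ 2"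
        by (simp add: E_def U_def V_def power_divide power2_eq_square)
      have "U ^ i * V ^ j \<le> E"
      proof -
        consider "i \<ge> 3" | "i \<ge> 1" "j \<ge> 1" | "j \<ge> 2"
          using p ij by (fastforce simp: L_def)
        then show ?thesis
        proof cases
          case 1
          then have "U ^ i * V ^ j \<le> U ^ 3 * 1"
            using UV by (intro mult_mono power_decreasing power_le_one) auto
          then show ?thesis unfolding E using UV by (simp add: add_increasing2)
        next
          case 2
          then have "U ^ i * V ^ j \<le> U ^ 1 * V ^ 1"
            using UV by (intro mult_mono power_decreasing) auto
          moreover have "0 \<le> U ^ 3" "0 \<le> V ^ 2" using UV by auto
          ultimately show ?thesis unfolding E power_one_right by linarith
        next
          case 3
          then have "U ^ i * V ^ j \<le> 1 * V ^ 2"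
            using UV by (intro mult_mono power_decreasing power_le_one) auto
          then show ?thesis unfolding E using UV by (simp add: add_increasing)
        qed
      qed
      moreover have "\<bar>u\<bar> ^ i = r ^ i * U ^ i" "\<bar>v\<bar> ^ j = r ^ j * V ^ j"
        using r by (auto simp: U_def V_def power_divide)
      ultimately have "\<bar>u\<bar> ^ i * \<bar>v\<bar> ^ j \<le> r ^ i * r ^ j * E"
        using mult_left_mono[of "U ^ i * V ^ j" E "r ^ i * r ^ j"] r by (simp add: mult_ac)
      then have "\<bar>c i j\<bar> * (\<bar>u\<bar> ^ i * \<bar>v\<bar> ^ j) \<le> \<bar>c i j\<bar> * (r ^ i * r ^ j * E)"
        by (rule mult_left_mono) simp
      then show "norm (case p of (i, j) \<Rightarrow> c i j * u ^ i * v ^ j)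
          \<le> (case p of (i, j) \<Rightarrow> \<bar>c i j\<bar> * r ^ i * r ^ j * E)"
        by (simp add: ij abs_mult power_abs mult_ac)
    qed
    also have "\<dots> \<le> S * E"
      using \<open>S' \<le> S\<close> E0 by (rule mult_right_mono)
    also have "E \<le> (1 / r ^ 3 + 1 / r\<^sup>2) * (\<bar>u\<bar> ^ 3 + \<bar>u\<bar> * \<bar>v\<bar> + v\<^sup>2)"
    proof -
      have "0 \<le> \<bar>u\<bar> ^ 3 / r\<^sup>2" "0 \<le> \<bar>u\<bar> * \<bar>v\<bar> / r ^ 3" "0 \<le> v\<^sup>2 / r ^ 3"
        using r by auto
      then show ?thesis
        unfolding E_def by (simp add: ring_distribs add_divide_distrib)
    qed
    then have "S * E \<le> M * (\<bar>u\<bar> ^ 3 + \<bar>u\<bar> * \<bar>v\<bar> + v\<^sup>2)"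
      unfolding M_def mult.assoc using \<open>S \<ge> 0\<close> by (rule mult_left_mono)
    finally show ?thesis
      by (simp add: sumL)
  qed
  moreover have "M \<ge> 0" using \<open>S \<ge> 0\<close> r by (simp add: M_def)
  ultimately show ?thesis using that r by blast
qed

section \<open>Trapping of return arcs\<close>

lemma has_real_derivative_nonneg_imp_le:
  fixes h :: "real \<Rightarrow> real"
  assumes "a \<le> b"
    and "\<And>t. t \<in> {a..b} \<Longrightarrow> (h has_real_derivative h' t) (at t within {a..b})"
    and "\<And>t. t \<in> {a..b} \<Longrightarrow> h' t \<ge> 0"
  shows "h a \<le> h b"
proof (cases "a = b")
  case False
  with assms(1) have "a < b" by simp
  then show ?thesis
  proof (rule DERIV_nonneg_imp_increasing_open[OF less_imp_le])
    fix t assume "a < t" "t < b"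
    then show "\<exists>y. (h has_real_derivative y) (at t) \<and> 0 \<le> y"
      using assms(2,3)[of t] by (auto simp: at_within_Icc_at)
  next
    show "continuous_on {a..b} h"
      using assms(2) DERIV_continuous_on by blast
  qed
qed simp

text \<open>A continuity bootstrap. If \<open>\<rho>\<close> were reached, there would be a first
  time at which this happens; up to then \<open>N\<close> is at most \<open>\<rho>\<close>, so
  \<open>step\<close> makes it strictly smaller there, a contradiction.\<close>

lemma below_threshold:
  fixes N :: "real \<Rightarrow> real"
  assumes "continuous_on {a..b} N" "N a < \<rho>"
    and step: "\<And>t. t \<in> {a..b} \<Longrightarrow> (\<And>u. u \<in> {a..t} \<Longrightarrow> N u \<le> \<rho>) \<Longrightarrow> N t < \<rho>"
    and "t \<in> {a..b}"
  shows "N t < \<rho>"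
proof (rule ccontr)
  assume "\<not> N t < \<rho>"
  define S where "S = {u \<in> {a..b}. N u = \<rho>}"
  \<comment> \<open>By the intermediate value theorem a value above \<open>\<rho>\<close> is
    preceded by the value \<open>\<rho>\<close> itself; compactness of \<open>S\<close> then
    provides the first such time.\<close>
  have hits: "\<exists>v. v \<in> S \<and> v \<le> u" if "u \<in> {a..b}" "N u \<ge> \<rho>" for u
  proof -
    have "continuous_on {a..u} N"
      using assms(1) that by (auto intro: continuous_on_subset)
    then have "\<exists>v\<ge>a. v \<le> u \<and> N v = \<rho>"
      using that assms(2) by (intro IVT') auto
    then show ?thesis using that by (auto simp: S_def)
  qed
  have "S \<noteq> {}" using hits[of t] \<open>\<not> N t < \<rho>\<close> assms(4) by force
  moreover have "compact S"
  proof -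
    have "closed ({a..b} \<inter> N -` {\<rho>})"
      by (rule continuous_closed_preimage) (use assms(1) in auto)
    moreover have "S = {a..b} \<inter> N -` {\<rho>}" by (auto simp: S_def)
    ultimately show ?thesis
      by (metis compact_Icc compact_Int_closed inf_left_idem)
  qed
  ultimately obtain m where m: "m \<in> S" "\<And>u. u \<in> S \<Longrightarrow> m \<le> u"
    using compact_attains_inf by metis
  have "N u \<le> \<rho>" if "u \<in> {a..m}" for u
  proof (rule ccontr)
    assume "\<not> N u \<le> \<rho>"
    moreover have "u \<in> {a..b}" using that m(1) by (auto simp: S_def)
    ultimately obtain v where "v \<in> S" "v \<le> u"
      using hits[of u] by auto
    with m(2)[of v] that have "u = m" by auto
    with m(1) \<open>\<not> N u \<le> \<rho>\<close> show False by (simp add: S_def)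
  qed
  then have "N m < \<rho>" using m(1) by (intro step) (auto simp: S_def)
  with m(1) show False by (simp add: S_def)
qed

lemma bounded_on_symmetric_interval:
  fixes R :: "real \<Rightarrow> real"
  assumes "continuous_on {-D..D} R"
  obtains C where "C \<ge> 0" "\<And>u. \<bar>u\<bar> \<le> D \<Longrightarrow> \<bar>R u\<bar> \<le> C"
proof -
  have "bounded (R ` {-D..D})"
    by (intro compact_imp_bounded compact_continuous_image assms compact_Icc)
  then obtain C where "\<And>u. u \<in> {-D..D} \<Longrightarrow> \<bar>R u\<bar> \<le> C"
    unfolding bounded_iff by (metis imageI real_norm_def)
  then have "\<bar>R u\<bar> \<le> max C 0" if "\<bar>u\<bar> \<le> D" for u
    using that by (simp add: abs_le_iff minus_le_iff le_max_iff_disj)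
  then show ?thesis by (intro that[of "max C 0"]) auto
qed

text \<open>Near the origin the orbits are graphs, and \<open>slope\<close> is the slope \<open>dp/dx\<close> for the height
  \<open>p = \<plusminus>y \<ge> 0\<close> above the discontinuity line.\<close>

locale slope_field =
  fixes k :: nat and q M r :: real and F :: "real \<Rightarrow> real" and G :: "real \<Rightarrow> real \<Rightarrow> real"
  assumes k: "k \<ge> 1" and q: "q > 0" and M: "M \<ge> 0" and r: "r > 0"
    and F_bound: "\<bar>u\<bar> < r \<Longrightarrow> \<bar>F u\<bar> \<le> M"
    and G_bound: "\<bar>u\<bar> < r \<Longrightarrow> \<bar>v\<bar> < r \<Longrightarrow> \<bar>G u v\<bar> \<le> M"
begin

definition slope :: "real \<Rightarrow> real \<Rightarrow> real" where
  "slope u v = - q * u ^ (2 * k - 1) + u ^ (2 * k) * F u + v * G u v"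

text \<open>The Gronwall factor: \<open>M * (1 + 2 * k / q)\<close> is the growth rate with respect
  to x, and \<open>2 * r\<close> bounds the change of x inside the box.\<close>

definition D :: real where
  "D = exp (2 * r * (M * (1 + 2 * real k / q)))"

text \<open>\<open>D\<close> times the coefficient of the initial value
  \<open>q * x 0 ^ (2 * k) / (2 * k)\<close> of the Gronwall quantity.\<close>

definition B :: real where
  "B = D * q / (2 * real k)"

lemma D_ge_1: "D \<ge> 1"
  using q M r by (simp add: D_def)

lemma B_pos: "B > 0"
  using D_ge_1 q k by (simp add: B_def)

end

text \<open>The arc is kept parametrized by time, since only inside the box is \<open>x\<close> known to be monotone.
  A priori the arc may leave the box, where nothing is known about the field.\<close>

locale return_arc = slope_field +
  fixes s :: real and x p \<tau> :: "real \<Rightarrow> real"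
  assumes s: "s = 1 \<or> s = - 1"
    and dx: "t \<in> {0..1} \<Longrightarrow> (x has_real_derivative \<tau> t) (at t within {0..1})"
    and \<tau>_sign: "t \<in> {0..1} \<Longrightarrow> \<bar>x t\<bar> < r \<Longrightarrow> \<bar>p t\<bar> < r \<Longrightarrow> s * \<tau> t > 0"
    and dp: "t \<in> {0..1} \<Longrightarrow> \<bar>x t\<bar> < r \<Longrightarrow> \<bar>p t\<bar> < r \<Longrightarrow>
      (p has_real_derivative \<tau> t * slope (x t) (p t)) (at t within {0..1})"
    and cont_p: "continuous_on {0..1} p"
    and p0: "p 0 = 0" and p1: "p 1 = 0"
    and p_pos: "0 < t \<Longrightarrow> t < 1 \<Longrightarrow> p t > 0"
    and x0: "x 0 > 0"
    and small: "D * x 0 < r / 2" "B * x 0 ^ (2 * k) < r / 2" "D * x 0 * M < q"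
begin

lemma p_nonneg: "t \<in> {0..1} \<Longrightarrow> p t \<ge> 0"
  using p0 p1 p_pos[of t] by (cases "t = 0"; cases "t = 1") auto

text \<open>While the past lies in the box, x is monotone, so Gronwall's inequality can be run with
  x as the independent variable. The controlled quantity is a sum of two nonnegative parts, one for
  the height and one for the abscissa, so both are bounded at once.\<close>

lemma bounds_if_in_box:
  assumes t: "t \<in> {0..1}"
    and box: "\<And>u. u \<in> {0..t} \<Longrightarrow> \<bar>x u\<bar> < r \<and> \<bar>p u\<bar> < r"
  shows "\<bar>x t\<bar> \<le> D * x 0" "p t \<le> B * x 0 ^ (2 * k)"
proof -
  \<comment> \<open>The rate comes from bounding the error part of the slope by
    \<open>M * x ^ (2 * k) + M * p\<close>, where \<open>x ^ (2 * k)\<close> is at most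
    \<open>2 * k / q\<close> times \<open>K\<close>, and \<open>p\<close> at most
    \<open>K\<close>.\<close>
  define L where "L = M * (1 + 2 * real k / q)"
  have L: "L \<ge> 0" using M q by (simp add: L_def)
  \<comment> \<open>\<open>K\<close> is a first integral of the leading part of the slope, so it grows at most exponentially in \<open>x\<close>.\<close>
  define K where "K u = p u + q * x u ^ (2 * k) / (2 * real k)" for u
  define K' where "K' u = \<tau> u * (x u ^ (2 * k) * F (x u) + p u * G (x u) (p u))" for u
  have sub: "{0..t} \<subseteq> {0..1}" using t by auto
  have dK: "(K has_real_derivative K' u) (at u within {0..t})" if u: "u \<in> {0..t}" for u
  proof -
    have u1: "u \<in> {0..1}" using u t by auto
    have "((\<lambda>u. x u ^ (2 * k)) has_real_derivative real (2 * k) * (\<tau> u * x u ^ (2 * k - Suc 0)))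
        (at u within {0..1})"
      using dx[OF u1] by (rule DERIV_power)
    then have "(K has_real_derivative \<tau> u * slope (x u) (p u) +
        q * (real (2 * k) * (\<tau> u * x u ^ (2 * k - Suc 0))) / (2 * real k)) (at u within {0..1})"
      unfolding K_def using dp[OF u1] box[OF u]
      by (intro DERIV_add DERIV_cdivide DERIV_cmult) auto
    also have "\<tau> u * slope (x u) (p u) +
        q * (real (2 * k) * (\<tau> u * x u ^ (2 * k - Suc 0))) / (2 * real k) = K' u"
      using k by (simp add: slope_def K'_def field_simps)
    finally show ?thesis using sub by (rule DERIV_subset)
  qed
  have K0: "K u \<ge> 0" "p u \<le> K u" "q * x u ^ (2 * k) / (2 * real k) \<le> K u" if "u \<in> {0..1}" for u
    using p_nonneg[OF that] q k by (auto simp: K_def)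
  have K'_le: "K' u \<le> L * s * \<tau> u * K u" if u: "u \<in> {0..t}" for u
  proof -
    have u1: "u \<in> {0..1}" using u t by auto
    have "\<bar>x u ^ (2 * k) * F (x u) + p u * G (x u) (p u)\<bar> \<le> x u ^ (2 * k) * M + p u * M"
      using F_bound[of "x u"] G_bound[of "x u" "p u"] box[OF u] p_nonneg[OF u1]
      by (intro order_trans[OF abs_triangle_ineq] add_mono)
        (auto simp: abs_mult intro!: mult_left_mono)
    also have "\<dots> \<le> (2 * real k / q) * K u * M + K u * M"
    proof (intro add_mono mult_right_mono)
      show "x u ^ (2 * k) \<le> (2 * real k / q) * K u"
        using K0(3)[OF u1] q k by (simp add: field_simps)
    qed (use K0(2)[OF u1] M in auto)
    also have "\<dots> = L * K u"
      by (simp add: L_def algebra_simps)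
    finally have "\<bar>\<tau> u\<bar> * \<bar>x u ^ (2 * k) * F (x u) + p u * G (x u) (p u)\<bar> \<le> \<bar>\<tau> u\<bar> * (L * K u)"
      by (rule mult_left_mono) simp
    moreover have "\<bar>\<tau> u\<bar> = s * \<tau> u"
      using \<tau>_sign[OF u1] box[OF u] s by auto
    moreover have "K' u \<le> \<bar>\<tau> u\<bar> * \<bar>x u ^ (2 * k) * F (x u) + p u * G (x u) (p u)\<bar>"
      unfolding K'_def by (metis abs_ge_self abs_mult)
    ultimately show ?thesis by (simp add: mult_ac)
  qed
  \<comment> \<open>\<open>K * exp (- L * s * x)\<close> cannot increase; the minus sign adapts this
    to the monotonicity lemma.\<close>
  define H where "H u = - (K u * exp (- L * s * x u))" for u
  have dH: "(H has_real_derivative (L * s * \<tau> u * K u - K' u) * exp (- L * s * x u)) (at u within {0..t})"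
    if u: "u \<in> {0..t}" for u
  proof -
    have "(x has_real_derivative \<tau> u) (at u within {0..t})"
      using dx[of u] sub u by (auto intro: DERIV_subset)
    then show ?thesis
      unfolding H_def by (auto intro!: derivative_eq_intros dK[OF u] simp: algebra_simps)
  qed
  have "H 0 \<le> H t"
    by (rule has_real_derivative_nonneg_imp_le[OF _ dH]) (use t K'_le in auto)
  then have "K t * exp (- L * s * x t) \<le> K 0 * exp (- L * s * x 0)"
    by (simp add: H_def)
  then have "K t * exp (- L * s * x t) * exp (L * s * x t) \<le> K 0 * exp (- L * s * x 0) * exp (L * s * x t)"
    by (rule mult_right_mono) simp
  then have "K t \<le> K 0 * exp (L * (s * (x t - x 0)))"
    by (simp add: mult.assoc algebra_simps flip: exp_add)
  also have "exp (L * (s * (x t - x 0))) \<le> D"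
  proof -
    have "s * (x t - x 0) \<le> \<bar>x t\<bar> + \<bar>x 0\<bar>" using s by auto
    also have "\<dots> \<le> 2 * r" using box[of t] box[of 0] t by auto
    finally have "L * (s * (x t - x 0)) \<le> L * (2 * r)" using L by (rule mult_left_mono)
    then show ?thesis by (simp add: D_def L_def mult_ac)
  qed
  then have "K 0 * exp (L * (s * (x t - x 0))) \<le> K 0 * D"
    using K0(1)[of 0] by (intro mult_left_mono) auto
  finally have Kt: "K t \<le> B * x 0 ^ (2 * k)"
    by (simp add: K_def B_def p0 mult_ac)
  then show "p t \<le> B * x 0 ^ (2 * k)"
    using K0(2)[OF t] by linarith
  have "q * x t ^ (2 * k) / (2 * real k) \<le> B * x 0 ^ (2 * k)"
    using K0(3)[OF t] Kt by linarith
  then have "x t ^ (2 * k) \<le> D * x 0 ^ (2 * k)"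
    using q k by (simp add: B_def field_simps)
  \<comment> \<open>Enlarging \<open>D\<close> to its power, possible as \<open>D \<ge> 1\<close>,
    lets the root of order \<open>2 * k\<close> be taken without a new constant.\<close>
  also have "\<dots> \<le> D ^ (2 * k) * x 0 ^ (2 * k)"
    using D_ge_1 k x0 self_le_power[of D "2 * k"] by (intro mult_right_mono) auto
  finally have "\<bar>x t\<bar> ^ (2 * k) \<le> (D * x 0) ^ (2 * k)"
    by (simp add: power_mult_distrib power_even_abs)
  then show "\<bar>x t\<bar> \<le> D * x 0"
    using k D_ge_1 x0 by (subst (asm) power_mono_iff) auto
qed

text \<open>Bootstrap at half the size of the box: a past within \<open>r / 2\<close> lies in the
  open box, so the Gronwall bounds hold, and by \<open>small\<close> they are strictly below
  \<open>r / 2\<close>.\<close>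

lemma in_box:
  assumes "t \<in> {0..1}"
  shows "\<bar>x t\<bar> < r \<and> \<bar>p t\<bar> < r"
proof -
  have "max \<bar>x t\<bar> \<bar>p t\<bar> < r / 2"
  proof (rule below_threshold[where a = 0 and b = 1, OF _ _ _ assms])
    show "continuous_on {0..1} (\<lambda>t. max \<bar>x t\<bar> \<bar>p t\<bar>)"
      by (intro continuous_intros cont_p DERIV_continuous_on[OF dx])
    have "1 * x 0 \<le> D * x 0" using D_ge_1 x0 by (intro mult_right_mono) auto
    then show "max \<bar>x 0\<bar> \<bar>p 0\<bar> < r / 2"
      using small(1) x0 p0 r by linarith
  next
    fix t :: real assume t: "t \<in> {0..1}" and *: "\<And>u. u \<in> {0..t} \<Longrightarrow> max \<bar>x u\<bar> \<bar>p u\<bar> \<le> r / 2"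
    have "\<bar>x u\<bar> < r \<and> \<bar>p u\<bar> < r" if "u \<in> {0..t}" for u
      using *[OF that] r by (auto simp: max_def split: if_splits)
    from bounds_if_in_box[OF t this] show "max \<bar>x t\<bar> \<bar>p t\<bar> < r / 2"
      using small p_nonneg[OF t] by simp
  qed
  then show ?thesis using r by (auto simp: max_def split: if_splits)
qed

lemma bounds:
  assumes "t \<in> {0..1}"
  shows "\<bar>x t\<bar> \<le> D * x 0" "p t \<le> B * x 0 ^ (2 * k)"
  using bounds_if_in_box[OF assms] in_box assms by auto

text \<open>On the range of abscissas open to the arc, \<open>D * x 0 * M < q\<close> makes the
  leading term outweigh the contribution of \<open>F\<close>.\<close>

lemma slope_on_axis_neg:
  assumes "0 < u" "u \<le> D * x 0"
  shows "slope u 0 < 0"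
proof -
  have "u < r" using assms small(1) r by linarith
  then have "\<bar>F u\<bar> \<le> M" using F_bound assms by simp
  then have "u * F u \<le> u * M" using assms by (intro mult_left_mono) auto
  also have "\<dots> \<le> D * x 0 * M" using assms M by (intro mult_right_mono)
  also have "\<dots> < q" by (rule small)
  finally have "u ^ (2 * k - 1) * (u * F u - q) < 0"
    using assms by (simp add: mult_less_0_iff)
  moreover have "u ^ (2 * k) = u ^ (2 * k - 1) * u"
    using k by (simp flip: power_Suc2)
  ultimately show ?thesis by (simp add: slope_def algebra_simps)
qed

lemma dp': "t \<in> {0..1} \<Longrightarrow> (p has_real_derivative \<tau> t * slope (x t) (p t)) (at t within {0..1})"
  using dp in_box by blast

text \<open>If x increased at first, the negative slope on the positive axis would push the height
  below 0 right after the start. Hence x decreases, whatever the direction of time and the sign of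
  the field.\<close>

lemma s_eq: "s = - 1"
proof (rule ccontr)
  assume "s \<noteq> - 1"
  with s have "\<tau> 0 > 0" using \<tau>_sign[of 0] in_box[of 0] by auto
  moreover have "1 * x 0 \<le> D * x 0" using D_ge_1 x0 by (intro mult_right_mono) auto
  ultimately have "\<tau> 0 * slope (x 0) 0 < 0"
    using slope_on_axis_neg[of "x 0"] x0 by (simp add: mult_less_0_iff)
  from has_real_derivative_neg_dec_right[OF dp'[of 0, unfolded p0] this]
  obtain d where d: "d > 0" "\<And>h. 0 < h \<Longrightarrow> 0 + h \<in> {0..1} \<Longrightarrow> h < d \<Longrightarrow> p (0 + h) < p 0"
    by auto
  define h where "h = min (d / 2) (1 / 2)"
  have "0 < h" "h < 1" "h < d" using d(1) by (auto simp: h_def)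
  with d(2)[of h] p_pos[of h] p0 show False by simp
qed

lemma \<tau>_neg: "t \<in> {0..1} \<Longrightarrow> \<tau> t < 0"
  using \<tau>_sign[of t] in_box[of t] s_eq by auto

text \<open>At an end point with positive abscissa the slope is negative while x decreases, so the
  height would be increasing there and negative just before the end.\<close>

lemma x1_nonpos: "x 1 \<le> 0"
proof (rule ccontr)
  assume "\<not> x 1 \<le> 0"
  then have "slope (x 1) 0 < 0" using slope_on_axis_neg[of "x 1"] bounds(1)[of 1] by simp
  then have "\<tau> 1 * slope (x 1) 0 > 0" using \<tau>_neg[of 1] by (simp add: mult_neg_neg)
  from has_real_derivative_pos_inc_left[OF dp'[of 1, unfolded p1] this]
  obtain d where d: "d > 0" "\<And>h. 0 < h \<Longrightarrow> 1 - h \<in> {0..1} \<Longrightarrow> h < d \<Longrightarrow> p (1 - h) < p 1"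
    by auto
  define h where "h = min (d / 2) (1 / 2)"
  have "0 < h" "h < 1" "h < d" using d(1) by (auto simp: h_def)
  with d(2)[of h] p_pos[of "1 - h"] p1 show False by simp
qed

text \<open>Integration along the arc with x as variable: \<open>h'\<close> stands for dh/dx, and
  \<open>(1 + D) * x 0\<close> bounds the distance that x travels. Integrals are avoided by the
  monotonicity of \<open>C * x + h\<close> and \<open>C * x - h\<close>.\<close>

lemma abs_change_le:
  assumes "\<And>t. t \<in> {0..1} \<Longrightarrow> (h has_real_derivative \<tau> t * h' t) (at t within {0..1})"
    and "\<And>t. t \<in> {0..1} \<Longrightarrow> \<bar>h' t\<bar> \<le> C"
    and "t \<in> {0..1}"
  shows "\<bar>h t - h 0\<bar> \<le> C * (1 + D) * x 0"
proof -
  have sub: "{0..t} \<subseteq> {0..1}" using assms(3) by auto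
  have C: "C \<ge> 0" using assms(2)[of 0] by simp
  have le: "\<sigma> * h t - C * x 0 \<le> \<sigma> * h 0 - C * x t" if \<sigma>: "\<sigma> = 1 \<or> \<sigma> = -1" for \<sigma>
  proof -
    have "- (\<sigma> * h 0 + C * x 0) \<le> - (\<sigma> * h t + C * x t)"
    proof (rule has_real_derivative_nonneg_imp_le[where h = "\<lambda>t. - (\<sigma> * h t + C * x t)"])
      fix u assume u: "u \<in> {0..t}"
      show "((\<lambda>t. - (\<sigma> * h t + C * x t)) has_real_derivative - (\<sigma> * (\<tau> u * h' u) + C * \<tau> u))
          (at u within {0..t})"
        by (intro DERIV_minus DERIV_add DERIV_cmult DERIV_subset[OF assms(1) sub]
            DERIV_subset[OF dx sub]) (use u assms(3) in auto)
      have "\<bar>h' u\<bar> \<le> C" "\<tau> u < 0" using assms(2)[of u] \<tau>_neg[of u] u assms(3) by auto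
      moreover from this \<sigma> have "0 \<le> C + \<sigma> * h' u" by auto
      ultimately have "\<tau> u * (C + \<sigma> * h' u) \<le> 0" by (simp add: mult_le_0_iff)
      then show "0 \<le> - (\<sigma> * (\<tau> u * h' u) + C * \<tau> u)" by (simp add: algebra_simps)
    qed (use assms(3) in auto)

    then show ?thesis by (simp add: algebra_simps)
  qed
  from le[of 1] le[of "-1"] have "\<bar>h t - h 0\<bar> \<le> C * (x 0 - x t)"
    by (auto simp: algebra_simps abs_le_iff)
  also have "\<dots> \<le> C * ((1 + D) * x 0)"
    using bounds(1)[OF assms(3)] C by (intro mult_left_mono) (auto simp: algebra_simps)
  finally show ?thesis by (simp add: mult_ac)
qed

end

section \<open>The relation between the end points of a return arc\<close>

text \<open>On an arc \<open>v\<close> has weight \<open>2 * k \<ge> 2\<close>, so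
  \<open>u * v\<close> and \<open>v\<^sup>2\<close> belong to the cubic error, and
  \<open>d * v\<close> is the only term in \<open>v\<close> to be kept.\<close>

locale slope_jet = slope_field +
  fixes F0 F1 F2 c0 c1 c2 d :: real
  assumes F_rem: "\<bar>u\<bar> < r \<Longrightarrow> \<bar>F u - (F0 + F1 * u + F2 * u\<^sup>2)\<bar> \<le> M * \<bar>u\<bar> ^ 3"
    and G_rem: "\<bar>u\<bar> < r \<Longrightarrow> \<bar>v\<bar> < r \<Longrightarrow>
      \<bar>G u v - (c0 + c1 * u + c2 * u\<^sup>2 + d * v)\<bar> \<le> M * (\<bar>u\<bar> ^ 3 + \<bar>u\<bar> * \<bar>v\<bar> + v\<^sup>2)"
begin

text \<open>\<open>E\<close> is the cubic Taylor polynomial of the integrating factor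
  \<open>exp (- \<integral> (c0 + c1 u + c2 u\<^sup>2) du)\<close>, and \<open>P'\<close> consists of the first four terms of
  \<open>E u * slope u 0\<close>.\<close>

definition E1 :: real where "E1 = - c0"
definition E2 :: real where "E2 = (c0\<^sup>2 - c1) / 2"
definition E3 :: real where "E3 = - c2 / 3 + c0 * c1 / 2 - c0 ^ 3 / 6"

definition E :: "real \<Rightarrow> real" where "E u = 1 + E1 * u + E2 * u\<^sup>2 + E3 * u ^ 3"

definition E' :: "real \<Rightarrow> real" where "E' u = E1 + 2 * E2 * u + 3 * E3 * u\<^sup>2"

definition b1 :: real where "b1 = F0 - E1 * q"
definition b2 :: real where "b2 = F1 + E1 * F0 - E2 * q"
definition b3 :: real where "b3 = F2 + E1 * F1 + E2 * F0 - E3 * q"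

definition P :: "real \<Rightarrow> real" where
  "P u = - q / (2 * real k) * u ^ (2 * k) + b1 / (2 * real k + 1) * u ^ (2 * k + 1)
    + b2 / (2 * real k + 2) * u ^ (2 * k + 2) + b3 / (2 * real k + 3) * u ^ (2 * k + 3)"

definition P' :: "real \<Rightarrow> real" where
  "P' u = u ^ (2 * k - 1) * (- q + b1 * u + b2 * u\<^sup>2 + b3 * u ^ 3)"

lemma DERIV_P: "(P has_real_derivative P' u) (at u)"
proof -
  have mono: "((\<lambda>u. b / real n * u ^ n) has_real_derivative b * u ^ (n - 1)) (at u)" if "n > 0" for b n
    using that by (auto intro!: derivative_eq_intros)
  from k have pw: "u ^ (2 * k) = u ^ (2 * k - 1) * u" "u ^ (2 * k + 1) = u ^ (2 * k - 1) * u\<^sup>2"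
    "u ^ (2 * k + 2) = u ^ (2 * k - 1) * u ^ 3"
    by (auto simp flip: power_Suc2 power_add)
  have "((\<lambda>u. - q / real (2 * k) * u ^ (2 * k) + b1 / real (2 * k + 1) * u ^ (2 * k + 1)
      + b2 / real (2 * k + 2) * u ^ (2 * k + 2) + b3 / real (2 * k + 3) * u ^ (2 * k + 3))
    has_real_derivative (- q * u ^ (2 * k - 1) + b1 * u ^ (2 * k + 1 - 1)
      + b2 * u ^ (2 * k + 2 - 1) + b3 * u ^ (2 * k + 3 - 1))) (at u)"
    using k by (intro DERIV_add mono) auto
  also have "- q * u ^ (2 * k - 1) + b1 * u ^ (2 * k + 1 - 1)
      + b2 * u ^ (2 * k + 2 - 1) + b3 * u ^ (2 * k + 3 - 1) = P' u"
  proof -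
    have "2 * k + 1 - 1 = 2 * k" "2 * k + 2 - 1 = 2 * k + 1" "2 * k + 3 - 1 = 2 * k + 2" by auto
    then show ?thesis unfolding P'_def by (simp only: pw) (simp add: algebra_simps)
  qed
  finally show ?thesis
    unfolding P_def[abs_def] by (simp add: add.commute)
qed

text \<open>\<open>E\<close> solves E' = -(c0 + c1 u + c2 u^2) E up to cubic terms, and
  \<open>P'\<close> matches \<open>E u * slope u 0\<close> up to order \<open>2 * k + 2\<close>. The
  identity lists what is left over, each summand being visibly of high weight.\<close>

lemma defect_split:
  "E' u * v + E u * slope u v - P' u - d * v\<^sup>2 =
    v * u ^ 3 * (E1 * c2 + E2 * c1 + E3 * c0 + (E2 * c2 + E3 * c1) * u + E3 * c2 * u\<^sup>2)
    + d * v\<^sup>2 * u * (E1 + E2 * u + E3 * u\<^sup>2)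
    + E u * v * (G u v - (c0 + c1 * u + c2 * u\<^sup>2 + d * v))
    + u ^ (2 * k + 3) * (E3 * F0 + E2 * F1 + E1 * F2 + (E3 * F1 + E2 * F2) * u + E3 * F2 * u\<^sup>2)
    + E u * u ^ (2 * k) * (F u - (F0 + F1 * u + F2 * u\<^sup>2))"
proof -
  \<comment> \<open>Naming the power with the truncated subtraction leaves a polynomial identity;
    \<open>k \<ge> 1\<close> relates the other powers to it.\<close>
  obtain z where "z = u ^ (2 * k - 1)" by blast
  then have z: "u ^ (2 * k - 1) = z" "u ^ (2 * k) = z * u" "u ^ (2 * k + 3) = z * u ^ 4"
    using k by (simp_all flip: power_Suc2 power_add) (simp add: add.commute)
  show ?thesis
    unfolding slope_def P'_def z E_def E'_def b1_def b2_def b3_def E1_def E2_def E3_def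
    by (simp add: field_simps power2_eq_square power3_eq_cube power4_eq_xxxx)
qed

text \<open>Here \<open>y\<close> stands for the start of the arc. Each summand of the splitting is
  a bounded polynomial or a remainder times a monomial of weight at least
  \<open>2 * k + 3\<close>.\<close>

lemma defect_bound:
  obtains C where "C \<ge> 0"
    "\<And>u v y. 0 < y \<Longrightarrow> y \<le> 1 \<Longrightarrow> \<bar>u\<bar> < r \<Longrightarrow> \<bar>v\<bar> < r \<Longrightarrow> \<bar>u\<bar> \<le> D * y \<Longrightarrow> \<bar>v\<bar> \<le> B * y ^ (2 * k) \<Longrightarrow>
      \<bar>E' u * v + E u * slope u v - P' u - d * v\<^sup>2\<bar> \<le> C * y ^ (2 * k + 3)"
proof -
  obtain A where A: "A \<ge> 0" "\<And>u. \<bar>u\<bar> \<le> D \<Longrightarrow> \<bar>E u\<bar> \<le> A"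
    by (rule bounded_on_symmetric_interval[of D E]) (auto simp: E_def intro!: continuous_intros)
  define R1 where "R1 u = E1 * c2 + E2 * c1 + E3 * c0 + (E2 * c2 + E3 * c1) * u + E3 * c2 * u\<^sup>2" for u
  obtain A1 where A1: "A1 \<ge> 0" "\<And>u. \<bar>u\<bar> \<le> D \<Longrightarrow> \<bar>R1 u\<bar> \<le> A1"
    by (rule bounded_on_symmetric_interval[of D R1]) (auto simp: R1_def intro!: continuous_intros)
  define R2 where "R2 u = E1 + E2 * u + E3 * u\<^sup>2" for u
  obtain A2 where A2: "A2 \<ge> 0" "\<And>u. \<bar>u\<bar> \<le> D \<Longrightarrow> \<bar>R2 u\<bar> \<le> A2"
    by (rule bounded_on_symmetric_interval[of D R2]) (auto simp: R2_def intro!: continuous_intros)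
  define R3 where "R3 u = E3 * F0 + E2 * F1 + E1 * F2 + (E3 * F1 + E2 * F2) * u + E3 * F2 * u\<^sup>2" for u
  obtain A3 where A3: "A3 \<ge> 0" "\<And>u. \<bar>u\<bar> \<le> D \<Longrightarrow> \<bar>R3 u\<bar> \<le> A3"
    by (rule bounded_on_symmetric_interval[of D R3]) (auto simp: R3_def intro!: continuous_intros)
  define C where "C = B * D ^ 3 * A1 + \<bar>d\<bar> * B\<^sup>2 * D * A2 + A * B * (M * (D ^ 3 + D * B + B\<^sup>2))
    + D ^ (2 * k + 3) * A3 + A * D ^ (2 * k) * (M * D ^ 3)"
  have D: "D > 0" using D_ge_1 by simp
  have "\<bar>E' u * v + E u * slope u v - P' u - d * v\<^sup>2\<bar> \<le> C * y ^ (2 * k + 3)"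
    if y: "0 < y" "y \<le> 1" and box: "\<bar>u\<bar> < r" "\<bar>v\<bar> < r"
      and u: "\<bar>u\<bar> \<le> D * y" and v: "\<bar>v\<bar> \<le> B * y ^ (2 * k)" for u v y
  proof -
    have "D * y \<le> D" using y D by simp
    with u have uD: "\<bar>u\<bar> \<le> D" by linarith
    have y_le: "y ^ n \<le> y ^ m" if "m \<le> n" for m n
      using y that by (intro power_decreasing) auto
    have un: "\<bar>u\<bar> ^ n \<le> D ^ n * y ^ n" for n
      using power_mono[OF u, of n] by (simp add: power_mult_distrib)
    have v2: "v\<^sup>2 \<le> B\<^sup>2 * y ^ (4 * k)"
      using power_mono[OF v, of 2] by (simp add: power_mult_distrib flip: power_mult)
    have t1: "\<bar>v * u ^ 3 * R1 u\<bar> \<le> B * D ^ 3 * A1 * y ^ (2 * k + 3)"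
    proof -
      have "\<bar>v * u ^ 3 * R1 u\<bar> = \<bar>v\<bar> * \<bar>u\<bar> ^ 3 * \<bar>R1 u\<bar>" by (simp add: abs_mult power_abs)
      also have "\<dots> \<le> (B * y ^ (2 * k)) * (D ^ 3 * y ^ 3) * A1"
        by (intro mult_mono v un A1 uD) (use B_pos D y in auto)
      finally show ?thesis by (simp add: power_add mult_ac)
    qed
    have t2: "\<bar>d * v\<^sup>2 * u * R2 u\<bar> \<le> \<bar>d\<bar> * B\<^sup>2 * D * A2 * y ^ (2 * k + 3)"
    proof -
      have "\<bar>d * v\<^sup>2 * u * R2 u\<bar> = \<bar>d\<bar> * v\<^sup>2 * \<bar>u\<bar> * \<bar>R2 u\<bar>" by (simp add: abs_mult)
      also have "\<dots> \<le> \<bar>d\<bar> * (B\<^sup>2 * y ^ (4 * k)) * (D * y) * A2"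
        by (intro mult_mono v2 u A2 uD order_refl) (use B_pos D y in auto)
      also have "\<dots> = \<bar>d\<bar> * B\<^sup>2 * D * A2 * y ^ (4 * k + 1)" by (simp add: mult_ac)
      \<comment> \<open>\<open>4 * k + 1 \<ge> 2 * k + 3\<close> is equivalent to
        \<open>k \<ge> 1\<close>, and \<open>y \<le> 1\<close>.\<close>
      also have "\<dots> \<le> \<bar>d\<bar> * B\<^sup>2 * D * A2 * y ^ (2 * k + 3)"
        by (intro mult_left_mono y_le) (use k B_pos D A2 in auto)
      finally show ?thesis .
    qed
    have t3: "\<bar>E u * v * (G u v - (c0 + c1 * u + c2 * u\<^sup>2 + d * v))\<bar>
        \<le> A * B * (M * (D ^ 3 + D * B + B\<^sup>2)) * y ^ (2 * k + 3)"
    proof -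
      have "\<bar>u\<bar> * \<bar>v\<bar> \<le> (D * y) * (B * y ^ (2 * k))"
        by (intro mult_mono u v) (use D y in auto)
      also have "\<dots> = D * B * y ^ (2 * k + 1)" by (simp add: mult_ac)
      also have "\<dots> \<le> D * B * y ^ 3"
        by (intro mult_left_mono y_le) (use k B_pos D in auto)
      finally have uv: "\<bar>u\<bar> * \<bar>v\<bar> \<le> D * B * y ^ 3" .
      have "B\<^sup>2 * y ^ (4 * k) \<le> B\<^sup>2 * y ^ 3"
        by (intro mult_left_mono y_le) (use k in auto)
      with v2 have "v\<^sup>2 \<le> B\<^sup>2 * y ^ 3" by linarith
      with uv un[of 3] have "\<bar>u\<bar> ^ 3 + \<bar>u\<bar> * \<bar>v\<bar> + v\<^sup>2 \<le> (D ^ 3 + D * B + B\<^sup>2) * y ^ 3"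
        by (simp add: algebra_simps)
      then have "M * (\<bar>u\<bar> ^ 3 + \<bar>u\<bar> * \<bar>v\<bar> + v\<^sup>2) \<le> M * ((D ^ 3 + D * B + B\<^sup>2) * y ^ 3)"
        using M by (rule mult_left_mono)
      with G_rem[OF box] have g: "\<bar>G u v - (c0 + c1 * u + c2 * u\<^sup>2 + d * v)\<bar>
          \<le> M * ((D ^ 3 + D * B + B\<^sup>2) * y ^ 3)"
        by linarith
      have "\<bar>E u * v * (G u v - (c0 + c1 * u + c2 * u\<^sup>2 + d * v))\<bar>
          = \<bar>E u\<bar> * \<bar>v\<bar> * \<bar>G u v - (c0 + c1 * u + c2 * u\<^sup>2 + d * v)\<bar>"
        by (simp add: abs_mult)
      also have "\<dots> \<le> A * (B * y ^ (2 * k)) * (M * ((D ^ 3 + D * B + B\<^sup>2) * y ^ 3))"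
        by (intro mult_mono A uD v g) (use A B_pos D y in auto)
      finally show ?thesis by (simp add: power_add mult_ac)
    qed
    have t4: "\<bar>u ^ (2 * k + 3) * R3 u\<bar> \<le> D ^ (2 * k + 3) * A3 * y ^ (2 * k + 3)"
    proof -
      have "\<bar>u ^ (2 * k + 3) * R3 u\<bar> = \<bar>u\<bar> ^ (2 * k + 3) * \<bar>R3 u\<bar>"
        by (simp only: abs_mult power_abs)
      also have "\<dots> \<le> (D ^ (2 * k + 3) * y ^ (2 * k + 3)) * A3"
        by (intro mult_mono un A3 uD) (use D y in auto)
      finally show ?thesis by (simp only: mult_ac)
    qed
    have t5: "\<bar>E u * u ^ (2 * k) * (F u - (F0 + F1 * u + F2 * u\<^sup>2))\<bar>
        \<le> A * D ^ (2 * k) * (M * D ^ 3) * y ^ (2 * k + 3)"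
    proof -
      have "M * \<bar>u\<bar> ^ 3 \<le> M * (D ^ 3 * y ^ 3)"
        using un M by (intro mult_left_mono)
      with F_rem[OF box(1)] have f: "\<bar>F u - (F0 + F1 * u + F2 * u\<^sup>2)\<bar> \<le> M * (D ^ 3 * y ^ 3)"
        by linarith
      have "\<bar>E u * u ^ (2 * k) * (F u - (F0 + F1 * u + F2 * u\<^sup>2))\<bar>
          = \<bar>E u\<bar> * \<bar>u\<bar> ^ (2 * k) * \<bar>F u - (F0 + F1 * u + F2 * u\<^sup>2)\<bar>"
        by (simp only: abs_mult power_abs)
      also have "\<dots> \<le> A * (D ^ (2 * k) * y ^ (2 * k)) * (M * (D ^ 3 * y ^ 3))"
        by (intro mult_mono A uD un f) (use A D y in auto)
      finally show ?thesis by (simp add: power_add mult_ac)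
    qed
    have "C * y ^ (2 * k + 3) = B * D ^ 3 * A1 * y ^ (2 * k + 3) + \<bar>d\<bar> * B\<^sup>2 * D * A2 * y ^ (2 * k + 3)
      + A * B * (M * (D ^ 3 + D * B + B\<^sup>2)) * y ^ (2 * k + 3) + D ^ (2 * k + 3) * A3 * y ^ (2 * k + 3)
      + A * D ^ (2 * k) * (M * D ^ 3) * y ^ (2 * k + 3)"
      unfolding C_def by (simp only: distrib_right)
    then show ?thesis
      unfolding defect_split R1_def[symmetric] R2_def[symmetric] R3_def[symmetric]
      using t1 t2 t3 t4 t5 by linarith
  qed
  moreover have "C \<ge> 0"
    unfolding C_def using A A1 A2 A3 B_pos D M by auto
  ultimately show ?thesis using that by blast
qed

text \<open>The quadratic term \<open>d v\<^sup>2\<close> of the slope contributes at the order considered only if \<open>k = 1\<close>;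
  it is then integrated along the parabola \<open>v = q (y\<^sup>2 - u\<^sup>2) / 2\<close> approximating the arc.\<close>

definition \<theta> :: real where
  "\<theta> = (if k = 1 then d * q\<^sup>2 / 4 else 0)"

text \<open>A primitive in \<open>u\<close> of the squared parabola without its factor
  \<open>q\<^sup>2 / 4\<close>, which sits in \<open>\<theta>\<close>. Its change from
  \<open>y\<close> to \<open>- y\<close> is \<open>- 16 / 15 * y ^ 5\<close>, the source of the
  constant in \<xi>.\<close>

definition Q :: "real \<Rightarrow> real \<Rightarrow> real" where
  "Q y u = u ^ 5 / 5 - 2 * y\<^sup>2 * u ^ 3 / 3 + y ^ 4 * u"

lemma DERIV_Q: "(Q y has_real_derivative (u\<^sup>2 - y\<^sup>2)\<^sup>2) (at u)"
  unfolding Q_def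
  by (auto intro!: derivative_eq_intros simp: power2_eq_square power4_eq_xxxx power3_eq_cube algebra_simps)

text \<open>For \<open>k \<ge> 2\<close> the square of the height has weight
  \<open>4 * k \<ge> 2 * k + 3\<close>. For \<open>k = 1\<close> the height differs from the
  parabola by third order; as a difference of squares carries a further factor of second order, the
  error is of order 5.\<close>

lemma quadratic_defect_bound:
  obtains C where "C \<ge> 0"
    "\<And>s x p \<tau> t. return_arc k q M r F G s x p \<tau> \<Longrightarrow> x 0 \<le> 1 \<Longrightarrow> t \<in> {0..1} \<Longrightarrow>
      \<bar>d * (p t)\<^sup>2 - \<theta> * ((x t)\<^sup>2 - (x 0)\<^sup>2)\<^sup>2\<bar> \<le> C * x 0 ^ (2 * k + 3)"
proof (cases "k = 1")
  case False
  have "\<bar>d * (p t)\<^sup>2 - \<theta> * ((x t)\<^sup>2 - (x 0)\<^sup>2)\<^sup>2\<bar> \<le> \<bar>d\<bar> * B\<^sup>2 * x 0 ^ (2 * k + 3)"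
    if arc: "return_arc k q M r F G s x p \<tau>" and x01: "x 0 \<le> 1" and t: "t \<in> {0..1}" for s x p \<tau> t
  proof -
    interpret return_arc k q M r F G s x p \<tau> by (rule arc)
    have "(p t)\<^sup>2 \<le> (B * x 0 ^ (2 * k))\<^sup>2"
      using bounds(2)[OF t] p_nonneg[OF t] by (rule power_mono)
    also have "\<dots> = B\<^sup>2 * x 0 ^ (4 * k)"
      by (simp add: power_mult_distrib flip: power_mult)
    also have "\<dots> \<le> B\<^sup>2 * x 0 ^ (2 * k + 3)"
      using k False x0 x01 by (intro mult_left_mono power_decreasing) auto
    finally have "\<bar>d\<bar> * (p t)\<^sup>2 \<le> \<bar>d\<bar> * (B\<^sup>2 * x 0 ^ (2 * k + 3))"
      by (rule mult_left_mono) simp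
    then show ?thesis using False by (simp add: \<theta>_def abs_mult mult_ac)
  qed
  then show ?thesis by (intro that[of "\<bar>d\<bar> * B\<^sup>2"]) auto
next
  case True
  define C1 where "C1 = M * (D\<^sup>2 + B) * (1 + D)"
  define C where "C = \<bar>d\<bar> * (C1 * (B + q * (1 + D\<^sup>2)))"
  have "\<bar>d * (p t)\<^sup>2 - \<theta> * ((x t)\<^sup>2 - (x 0)\<^sup>2)\<^sup>2\<bar> \<le> C * x 0 ^ (2 * k + 3)"
    if arc: "return_arc k q M r F G s x p \<tau>" and x01: "x 0 \<le> 1" and t: "t \<in> {0..1}" for s x p \<tau> t
  proof -
    interpret return_arc k q M r F G s x p \<tau> by (rule arc)
    \<comment> \<open>The deviation from the parabola. The leading part of the slope cancels in its
      derivative, leaving a quantity of second order over a distance of first order.\<close>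
    define h where "h t = p t - q / 2 * ((x 0)\<^sup>2 - (x t)\<^sup>2)" for t
    have x2: "(x u)\<^sup>2 \<le> D\<^sup>2 * (x 0)\<^sup>2" if "u \<in> {0..1}" for u
      using power_mono[OF bounds(1)[OF that], of 2] by (simp add: power_mult_distrib)
    have pB: "p u \<le> B * (x 0)\<^sup>2" if "u \<in> {0..1}" for u
      using bounds(2)[OF that] True by simp
    have "\<bar>h t - h 0\<bar> \<le> M * (D\<^sup>2 + B) * (x 0)\<^sup>2 * (1 + D) * x 0"
    proof (rule abs_change_le[OF _ _ t])
      fix u :: real assume u: "u \<in> {0..1}"
      have "((\<lambda>t. q / 2 * ((x 0)\<^sup>2 - (x t)\<^sup>2)) has_real_derivative q / 2 * (0 - 2 * (\<tau> u * x u)))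
        (at u within {0..1})"
        using dx[OF u] by (intro DERIV_cmult DERIV_diff DERIV_const) (auto intro!: derivative_eq_intros)
      then have "(h has_real_derivative \<tau> u * slope (x u) (p u) - q / 2 * (0 - 2 * (\<tau> u * x u)))
        (at u within {0..1})"
        unfolding h_def by (rule DERIV_diff[OF dp'[OF u]])
      also have "\<tau> u * slope (x u) (p u) - q / 2 * (0 - 2 * (\<tau> u * x u)) =
          \<tau> u * ((x u)\<^sup>2 * F (x u) + p u * G (x u) (p u))"
        unfolding slope_def unfolding True by (simp add: power2_eq_square algebra_simps)
      finally show "(h has_real_derivative \<tau> u * ((x u)\<^sup>2 * F (x u) + p u * G (x u) (p u)))
        (at u within {0..1})" .
      have "\<bar>(x u)\<^sup>2 * F (x u) + p u * G (x u) (p u)\<bar> \<le> (x u)\<^sup>2 * M + p u * M"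
        using F_bound[of "x u"] G_bound[of "x u" "p u"] in_box[OF u] p_nonneg[OF u]
        by (intro order_trans[OF abs_triangle_ineq] add_mono)
          (auto simp: abs_mult intro!: mult_left_mono)
      also have "\<dots> \<le> D\<^sup>2 * (x 0)\<^sup>2 * M + B * (x 0)\<^sup>2 * M"
        using x2[OF u] pB[OF u] M by (intro add_mono mult_right_mono)
      finally show "\<bar>(x u)\<^sup>2 * F (x u) + p u * G (x u) (p u)\<bar> \<le> M * (D\<^sup>2 + B) * (x 0)\<^sup>2"
        by (simp add: algebra_simps)
    qed
    then have h: "\<bar>h t\<bar> \<le> C1 * x 0 ^ 3"
      by (simp add: h_def p0 C1_def power2_eq_square power3_eq_cube mult_ac)
    have "\<bar>p t + q / 2 * ((x 0)\<^sup>2 - (x t)\<^sup>2)\<bar> \<le> p t + q * ((x 0)\<^sup>2 + (x t)\<^sup>2)"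
    proof -
      have "\<bar>(x 0)\<^sup>2 - (x t)\<^sup>2\<bar> \<le> 2 * ((x 0)\<^sup>2 + (x t)\<^sup>2)" by (simp add: abs_le_iff)
      then have "\<bar>q / 2 * ((x 0)\<^sup>2 - (x t)\<^sup>2)\<bar> \<le> q / 2 * (2 * ((x 0)\<^sup>2 + (x t)\<^sup>2))"
        using q by (simp only: abs_mult) simp
      moreover have "q / 2 * (2 * ((x 0)\<^sup>2 + (x t)\<^sup>2)) = q * ((x 0)\<^sup>2 + (x t)\<^sup>2)" by simp
      moreover note abs_triangle_ineq[of "p t" "q / 2 * ((x 0)\<^sup>2 - (x t)\<^sup>2)"] p_nonneg[OF t]
      ultimately show ?thesis by linarith
    qed
    also have "\<dots> \<le> B * (x 0)\<^sup>2 + q * ((x 0)\<^sup>2 + D\<^sup>2 * (x 0)\<^sup>2)"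
      using pB[OF t] x2[OF t] q by (intro add_mono mult_left_mono) auto
    also have "\<dots> = (B + q * (1 + D\<^sup>2)) * (x 0)\<^sup>2" by (simp add: algebra_simps)
    finally have g: "\<bar>p t + q / 2 * ((x 0)\<^sup>2 - (x t)\<^sup>2)\<bar> \<le> (B + q * (1 + D\<^sup>2)) * (x 0)\<^sup>2" .
    have "\<bar>d * (p t)\<^sup>2 - \<theta> * ((x t)\<^sup>2 - (x 0)\<^sup>2)\<^sup>2\<bar>
        = \<bar>d\<bar> * (\<bar>h t\<bar> * \<bar>p t + q / 2 * ((x 0)\<^sup>2 - (x t)\<^sup>2)\<bar>)"
      unfolding \<theta>_def h_def abs_mult[symmetric] using True
      by (simp add: power2_eq_square algebra_simps)
    also have "\<dots> \<le> \<bar>d\<bar> * ((C1 * x 0 ^ 3) * ((B + q * (1 + D\<^sup>2)) * (x 0)\<^sup>2))"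
      by (intro mult_left_mono mult_mono h g) (use x0 M B_pos D_ge_1 in \<open>auto simp: C1_def\<close>)
    also have "\<dots> = C * x 0 ^ (3 + 2)" by (simp add: C_def power_add mult_ac)
    finally show ?thesis using True by (simp add: numeral_eq_Suc)
  qed
  moreover have "C \<ge> 0" using M B_pos D_ge_1 q by (simp add: C_def C1_def)
  ultimately show ?thesis using that by blast
qed

text \<open>The quantity \<open>J\<close> below has derivative with respect to x equal to the
  defect, with the quadratic term traded for its value on the parabola. As the height vanishes at
  both ends, its total change involves the end points only; integration supplies the last power of
  \<open>x 0\<close>.\<close>

lemma return_relation:
  obtains C where
    "\<And>s x p \<tau>. return_arc k q M r F G s x p \<tau> \<Longrightarrow> x 0 \<le> 1 \<Longrightarrow>
      \<bar>P (x 1) - P (x 0) + \<theta> * (Q (x 0) (x 1) - Q (x 0) (x 0))\<bar> \<le> C * x 0 ^ (2 * k + 4)"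
proof -
  obtain C1 where C1: "C1 \<ge> 0"
    "\<And>u v y. 0 < y \<Longrightarrow> y \<le> 1 \<Longrightarrow> \<bar>u\<bar> < r \<Longrightarrow> \<bar>v\<bar> < r \<Longrightarrow> \<bar>u\<bar> \<le> D * y \<Longrightarrow> \<bar>v\<bar> \<le> B * y ^ (2 * k) \<Longrightarrow>
      \<bar>E' u * v + E u * slope u v - P' u - d * v\<^sup>2\<bar> \<le> C1 * y ^ (2 * k + 3)"
    using defect_bound by metis
  obtain C2 where C2: "C2 \<ge> 0"
    "\<And>s x p \<tau> t. return_arc k q M r F G s x p \<tau> \<Longrightarrow> x 0 \<le> 1 \<Longrightarrow> t \<in> {0..1} \<Longrightarrow>
      \<bar>d * (p t)\<^sup>2 - \<theta> * ((x t)\<^sup>2 - (x 0)\<^sup>2)\<^sup>2\<bar> \<le> C2 * x 0 ^ (2 * k + 3)"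
    using quadratic_defect_bound by metis
  have "\<bar>P (x 1) - P (x 0) + \<theta> * (Q (x 0) (x 1) - Q (x 0) (x 0))\<bar>
      \<le> (C1 + C2) * (1 + D) * x 0 ^ (2 * k + 4)"
    if arc: "return_arc k q M r F G s x p \<tau>" and x01: "x 0 \<le> 1" for s x p \<tau>
  proof -
    interpret return_arc k q M r F G s x p \<tau> by (rule arc)
    define J where "J t = E (x t) * p t - P (x t) - \<theta> * Q (x 0) (x t)" for t
    define J' where "J' t = E' (x t) * p t + E (x t) * slope (x t) (p t) - P' (x t)
      - \<theta> * ((x t)\<^sup>2 - (x 0)\<^sup>2)\<^sup>2" for t
    have DERIV_E: "(E has_real_derivative E' u) (at u)" for u
      unfolding E_def E'_def
      by (auto intro!: derivative_eq_intros simp: power2_eq_square algebra_simps)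
    have "\<bar>J 1 - J 0\<bar> \<le> (C1 + C2) * x 0 ^ (2 * k + 3) * (1 + D) * x 0"
    proof (rule abs_change_le)
      fix t :: real assume t: "t \<in> {0..1}"
      have "((\<lambda>t. E (x t)) has_real_derivative E' (x t) * \<tau> t) (at t within {0..1})"
        "((\<lambda>t. P (x t)) has_real_derivative P' (x t) * \<tau> t) (at t within {0..1})"
        "((\<lambda>t. Q (x 0) (x t)) has_real_derivative ((x t)\<^sup>2 - (x 0)\<^sup>2)\<^sup>2 * \<tau> t) (at t within {0..1})"
        by (rule DERIV_chain2[OF _ dx[OF t]], rule DERIV_E DERIV_P DERIV_Q)+
      from DERIV_diff[OF DERIV_diff[OF DERIV_mult[OF this(1) dp'[OF t]] this(2)] DERIV_cmult[OF this(3), of \<theta>]]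
      show "(J has_real_derivative \<tau> t * J' t) (at t within {0..1})"
        unfolding J_def J'_def by (simp add: algebra_simps)
      have "\<bar>E' (x t) * p t + E (x t) * slope (x t) (p t) - P' (x t) - d * (p t)\<^sup>2\<bar>
          \<le> C1 * x 0 ^ (2 * k + 3)"
        using bounds[OF t] p_nonneg[OF t] x0 x01 in_box[OF t] by (intro C1(2)) auto
      moreover note C2(2)[OF arc x01 t]
      ultimately have "\<bar>J' t\<bar> \<le> C1 * x 0 ^ (2 * k + 3) + C2 * x 0 ^ (2 * k + 3)"
        unfolding J'_def by linarith
      then show "\<bar>J' t\<bar> \<le> (C1 + C2) * x 0 ^ (2 * k + 3)" by (simp add: distrib_right)
    qed simp
    moreover have "J 1 - J 0 = - (P (x 1) - P (x 0) + \<theta> * (Q (x 0) (x 1) - Q (x 0) (x 0)))"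
      by (simp add: J_def p0 p1 algebra_simps)
    moreover have "x 0 ^ (2 * k + 4) = x 0 ^ (2 * k + 3) * x 0"
      by (simp add: numeral_eq_Suc)
    ultimately show ?thesis by (simp only: abs_minus_cancel mult_ac)
  qed
  then show ?thesis by (rule that)
qed

end

section \<open>Solving the relation for the coefficients\<close>

lemma fps_nth_mult_2: "fps_nth (f * g) 2 = fps_nth f 0 * fps_nth g 2 + fps_nth f 1 * fps_nth g 1
    + fps_nth f 2 * fps_nth g 0"
  by (simp add: fps_mult_nth numeral_eq_Suc)

lemma fps_nth_mult_3: "fps_nth (f * g) 3 = fps_nth f 0 * fps_nth g 3 + fps_nth f 1 * fps_nth g 2
    + fps_nth f 2 * fps_nth g 1 + fps_nth f 3 * fps_nth g 0"
  by (simp add: fps_mult_nth numeral_eq_Suc)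

lemma fps_nth_power_one_plus:
  fixes u :: "real fps"
  assumes "fps_nth u 0 = 1"
  shows "fps_nth (u ^ n) 1 = real n * fps_nth u 1"
    and "fps_nth (u ^ n) 2 = real n * fps_nth u 2 + real n * (real n - 1) / 2 * (fps_nth u 1)\<^sup>2"
    and "fps_nth (u ^ n) 3 = real n * fps_nth u 3 + real n * (real n - 1) * fps_nth u 1 * fps_nth u 2
      + real n * (real n - 1) * (real n - 2) / 6 * fps_nth u 1 ^ 3"
proof (induction n)
  case 0
  { case 1 then show ?case by simp next case 2 then show ?case by simp next case 3 then show ?case by simp }
next
  case (Suc n)
  have 0: "fps_nth (u ^ n) 0 = 1" by (simp add: fps_power_zeroth assms)
  { case 1
    then show ?case
      unfolding power_Suc fps_mult_nth_1 0 Suc(1) assms by (simp add: algebra_simps)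
  next
    case 2
    then show ?case
      unfolding power_Suc fps_nth_mult_2 0 Suc(1,2) assms
      by (simp add: field_simps power2_eq_square)
  next
    case 3
    then show ?case
      unfolding power_Suc fps_nth_mult_3 0 Suc assms
      by (simp add: field_simps power2_eq_square power3_eq_cube)
  }
qed

text \<open>The relation is triangular: at each order beyond the lowest, the new coefficient enters
  linearly with the nonzero factor \<open>A\<close>.\<close>

lemma return_series_coeffs:
  fixes \<alpha> :: "real fps" and A p1 p2 p3 \<theta> :: real and k :: nat
  defines "P \<equiv> \<lambda>U. fps_const (A / (2 * real k)) * U ^ (2 * k) + fps_const p1 * U ^ (2 * k + 1)
      + fps_const p2 * U ^ (2 * k + 2) + fps_const p3 * U ^ (2 * k + 3)"
    and "Q \<equiv> \<lambda>U. fps_const (1 / 5) * U ^ 5 - fps_const (2 / 3) * (fps_X\<^sup>2 * U ^ 3) + fps_X ^ 4 * U"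
  assumes k: "k \<ge> 1" and A: "A \<noteq> 0" and \<alpha>0: "fps_nth \<alpha> 0 = 0" and \<alpha>1: "fps_nth \<alpha> 1 \<le> 0"
    and \<theta>: "k = 1 \<or> \<theta> = 0"
    and zero: "\<And>m. m < 2 * k + 4 \<Longrightarrow>
      fps_nth (P \<alpha> - P fps_X + fps_const \<theta> * (Q \<alpha> - Q fps_X)) m = 0"
  shows "fps_nth \<alpha> 1 = -1"
    and "fps_nth \<alpha> 2 = - 2 * p1 / A"
    and "fps_nth \<alpha> 3 = - (fps_nth \<alpha> 2)\<^sup>2"
    and "fps_nth \<alpha> 4 = (2 * (real k)\<^sup>2 + 3 * real k + 7) / 6 * fps_nth \<alpha> 2 ^ 3
      - (2 * real k + 2) * p2 * fps_nth \<alpha> 2 / A - 2 * p3 / A - 16 * \<theta> / (15 * A)"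
proof -
  \<comment> \<open>With \<open>\<alpha> = - X u\<close> the relation becomes \<open>X ^ (2 k) * W = 0\<close> up to order \<open>2 k + 3\<close>.\<close>
  define u where "u = - fps_shift 1 \<alpha>"
  have \<alpha>: "\<alpha> = - (fps_X * u)"
    using \<alpha>0 by (auto simp: u_def fps_eq_iff)
  have un: "fps_nth \<alpha> (Suc n) = - fps_nth u n" for n
    by (simp add: \<alpha>)
  define V where "V j = u ^ (2 * k + j)" for j
  define W where "W = fps_const (A / (2 * real k)) * (V 0 - 1)
    - fps_X ^ 1 * (fps_const p1 * (V 1 + 1))
    + fps_X ^ 2 * (fps_const p2 * (V 2 - 1))
    - fps_X ^ 3 * (fps_const p3 * (V 3 + 1))
    + fps_X ^ 3 * (fps_const \<theta> * (fps_const (2 / 3) * (u ^ 3 + 1) - fps_const (1 / 5) * (u ^ 5 + 1) - (u + 1)))"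
  have even: "(- (fps_X * u)) ^ (2 * k) = fps_X ^ (2 * k) * u ^ (2 * k)"
    by (simp add: power_mult_distrib)
  have P: "P \<alpha> - P fps_X = fps_X ^ (2 * k) * (W
    - fps_X ^ 3 * (fps_const \<theta> * (fps_const (2 / 3) * (u ^ 3 + 1) - fps_const (1 / 5) * (u ^ 5 + 1) - (u + 1))))"
    unfolding P_def W_def V_def \<alpha> power_add even
    by (simp add: algebra_simps power2_eq_square power3_eq_cube)
  have Q: "fps_const \<theta> * (Q \<alpha> - Q fps_X) = fps_X ^ (2 * k) *
    (fps_X ^ 3 * (fps_const \<theta> * (fps_const (2 / 3) * (u ^ 3 + 1) - fps_const (1 / 5) * (u ^ 5 + 1) - (u + 1))))"
  \<comment> \<open>\<open>Q\<close> is homogeneous of degree 5, which equals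
    \<open>2 * k + 3\<close> only for \<open>k = 1\<close>; otherwise \<open>\<theta>\<close>
    vanishes.\<close>
  proof (cases "k = 1")
    case True
    show ?thesis
      unfolding True Q_def \<alpha>
      by (simp add: algebra_simps power2_eq_square power3_eq_cube eval_nat_numeral)
  qed (use \<theta> in simp)
  have "P \<alpha> - P fps_X + fps_const \<theta> * (Q \<alpha> - Q fps_X) = fps_X ^ (2 * k) * W"
    unfolding P Q by (simp add: algebra_simps)
  then have W: "fps_nth W m = 0" if "m < 4" for m
    using zero[of "2 * k + m"] that by (simp add: fps_X_power_mult_nth)
  \<comment> \<open>The lowest order leaves the roots 1 and -1, and the sign of
    \<open>fps_nth \<alpha> 1\<close> excludes the identity branch.\<close>
  have "fps_nth u 0 ^ (2 * k) = 1"
    using W[of 0] A k by (simp add: W_def V_def fps_X_power_mult_nth fps_power_zeroth)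
  moreover have "fps_nth u 0 \<ge> 0" using \<alpha>1 un[of 0] by simp
  ultimately have u0: "fps_nth u 0 = 1"
    using power_eq_iff_eq_base[of "2 * k" "fps_nth u 0" 1] k by auto
  define \<kappa> where "\<kappa> = real k"
  have \<kappa>: "\<kappa> > 0" using k by (simp add: \<kappa>_def)
  have V: "fps_nth (V j) 0 = 1"
    "fps_nth (V j) (Suc 0) = (2 * \<kappa> + real j) * fps_nth u 1"
    "fps_nth (V j) 2 = (2 * \<kappa> + real j) * fps_nth u 2
      + (2 * \<kappa> + real j) * (2 * \<kappa> + real j - 1) / 2 * (fps_nth u 1)\<^sup>2"
    "fps_nth (V j) 3 = (2 * \<kappa> + real j) * fps_nth u 3
      + (2 * \<kappa> + real j) * (2 * \<kappa> + real j - 1) * fps_nth u 1 * fps_nth u 2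
      + (2 * \<kappa> + real j) * (2 * \<kappa> + real j - 1) * (2 * \<kappa> + real j - 2) / 6 * fps_nth u 1 ^ 3" for j
    using fps_nth_power_one_plus[OF u0, of "2 * k + j"]
    by (simp_all add: V_def \<kappa>_def fps_power_zeroth u0)
  have W_nth: "fps_nth W 1 = A / (2 * \<kappa>) * fps_nth (V 0) 1 - 2 * p1"
    "fps_nth W 2 = A / (2 * \<kappa>) * fps_nth (V 0) 2 - p1 * fps_nth (V 1) 1"
    "fps_nth W 3 = A / (2 * \<kappa>) * fps_nth (V 0) 3 - p1 * fps_nth (V 1) 2 + p2 * fps_nth (V 2) 1
      - 2 * p3 - 16 / 15 * \<theta>"
    unfolding W_def by (simp_all add: fps_X_power_mult_nth V(1) u0 \<kappa>_def fps_power_zeroth)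
  have 1: "A * fps_nth u 1 = 2 * p1"
    using W[of 1] \<kappa> by (simp add: W_nth[unfolded One_nat_def] V)
  then have u1: "fps_nth u 1 = 2 * p1 / A" using A by (simp add: field_simps)
  \<comment> \<open>Expressing \<open>p1\<close> through the first coefficient makes the dependence
    on \<kappa> cancel at the next order, leaving \<open>u2 = u1\<^sup>2\<close>.\<close>
  have p1: "p1 = A * fps_nth u 1 / 2" using 1 by simp
  have "A / (2 * \<kappa>) * (2 * \<kappa> * fps_nth u 2 + 2 * \<kappa> * (2 * \<kappa> - 1) / 2 * (fps_nth u 1)\<^sup>2)
      - p1 * ((2 * \<kappa> + 1) * fps_nth u 1) = 0"
    using W[of 2] unfolding W_nth One_nat_def V by simp
  then have "A * (fps_nth u 2 - (fps_nth u 1)\<^sup>2) = 0"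
    unfolding p1 using \<kappa> by (simp add: field_simps power2_eq_square)
  then have u2: "fps_nth u 2 = (fps_nth u 1)\<^sup>2" using A by simp
  have "A / (2 * \<kappa>) * (2 * \<kappa> * fps_nth u 3 + 2 * \<kappa> * (2 * \<kappa> - 1) * fps_nth u 1 * fps_nth u 2
        + 2 * \<kappa> * (2 * \<kappa> - 1) * (2 * \<kappa> - 2) / 6 * fps_nth u 1 ^ 3)
      = A * (fps_nth u 3 + (2 * \<kappa> - 1) * fps_nth u 1 * fps_nth u 2
        + (2 * \<kappa> - 1) * (2 * \<kappa> - 2) / 6 * fps_nth u 1 ^ 3)"
    using \<kappa> by (simp add: field_simps)
  then have "A * (fps_nth u 3 + (2 * \<kappa> - 1) * fps_nth u 1 * fps_nth u 2
        + (2 * \<kappa> - 1) * (2 * \<kappa> - 2) / 6 * fps_nth u 1 ^ 3)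
      - p1 * ((2 * \<kappa> + 1) * fps_nth u 2 + (2 * \<kappa> + 1) * (2 * \<kappa>) / 2 * (fps_nth u 1)\<^sup>2)
      + p2 * ((2 * \<kappa> + 2) * fps_nth u 1) - 2 * p3 - 16 / 15 * \<theta> = 0"
    using W[of 3] unfolding W_nth One_nat_def V by simp
  then have "A * fps_nth u 3 = - A * (2 * \<kappa>\<^sup>2 + 3 * \<kappa> + 7) / 6 * (- (fps_nth u 1 ^ 3))
      - (2 * \<kappa> + 2) * p2 * fps_nth u 1 + 2 * p3 + 16 / 15 * \<theta>"
    unfolding p1 u2 by (simp add: field_simps power2_eq_square power3_eq_cube)
  then have u3: "fps_nth u 3 = (2 * \<kappa>\<^sup>2 + 3 * \<kappa> + 7) / 6 * fps_nth u 1 ^ 3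
      - (2 * \<kappa> + 2) * p2 * fps_nth u 1 / A + 2 * p3 / A + 16 * \<theta> / (15 * A)"
    using A by (simp add: field_simps)
  have a: "fps_nth \<alpha> 1 = - fps_nth u 0" "fps_nth \<alpha> 2 = - fps_nth u 1" "fps_nth \<alpha> 3 = - fps_nth u 2"
    "fps_nth \<alpha> 4 = - fps_nth u 3"
    using un[of 0] un[of 1] un[of 2] un[of 3] by (simp_all add: numeral_eq_Suc)
  show "fps_nth \<alpha> 1 = -1" using a(1) u0 by simp
  show "fps_nth \<alpha> 2 = - 2 * p1 / A" unfolding a u1 by simp
  show "fps_nth \<alpha> 3 = - (fps_nth \<alpha> 2)\<^sup>2" unfolding a u2 by simp
  show "fps_nth \<alpha> 4 = (2 * (real k)\<^sup>2 + 3 * real k + 7) / 6 * fps_nth \<alpha> 2 ^ 3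
      - (2 * real k + 2) * p2 * fps_nth \<alpha> 2 / A - 2 * p3 / A - 16 * \<theta> / (15 * A)"
    unfolding a u3 \<kappa>_def using A by (simp add: field_simps)
qed

lemma has_fps_expansion_pow:
  fixes f :: "real \<Rightarrow> real"
  assumes "f has_fps_expansion F"
  shows "(\<lambda>x. f x ^ n) has_fps_expansion F ^ n"
  by (induction n) (auto intro!: has_fps_expansion_mult assms)

section \<open>Coefficients of the return map of a slope field\<close>

context slope_jet
begin

text \<open>Along \<phi> the relation is an analytic function of the starting point with a bound of
  order \<open>2 * k + 4\<close>, so all its lower coefficients vanish.\<close>

lemma return_map_coeffs:
  fixes \<phi> :: "real \<Rightarrow> real" and \<alpha> :: "real fps"
  assumes \<phi>: "\<phi> has_fps_expansion \<alpha>" "\<phi> 0 = 0"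
    and arcs: "\<forall>\<^sub>F y in at_right 0. \<exists>s x p \<tau>. return_arc k q M r F G s x p \<tau> \<and> x 0 = y \<and> x 1 = \<phi> y"
  shows "fps_nth \<alpha> 1 = -1"
    and "fps_nth \<alpha> 2 = 2 * b1 / (q * (2 * real k + 1))"
    and "fps_nth \<alpha> 3 = - (fps_nth \<alpha> 2)\<^sup>2"
    and "fps_nth \<alpha> 4 = (2 * (real k)\<^sup>2 + 3 * real k + 7) / 6 * fps_nth \<alpha> 2 ^ 3
      + b2 * fps_nth \<alpha> 2 / q + 2 * b3 / (q * (2 * real k + 3)) + 16 * \<theta> / (15 * q)"
proof -
  obtain C where C: "\<And>s x p \<tau>. return_arc k q M r F G s x p \<tau> \<Longrightarrow> x 0 \<le> 1 \<Longrightarrow>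
      \<bar>P (x 1) - P (x 0) + \<theta> * (Q (x 0) (x 1) - Q (x 0) (x 0))\<bar> \<le> C * x 0 ^ (2 * k + 4)"
    using return_relation by metis
  have le1: "\<forall>\<^sub>F y in at_right (0::real). 0 < y \<and> y < 1"
    using eventually_at_right_real[of 0 "1::real"] by simp
  have bound: "\<forall>\<^sub>F y in at_right 0. \<bar>P (\<phi> y) - P y + \<theta> * (Q y (\<phi> y) - Q y y)\<bar> \<le> C * y ^ (2 * k + 4)"
    using arcs le1
  proof eventually_elim
    case (elim y)
    then obtain s x p \<tau> where "return_arc k q M r F G s x p \<tau>" "x 0 = y" "x 1 = \<phi> y" by blast
    with C[of s x p \<tau>] elim show ?case by simp
  qed
  have nonpos: "\<forall>\<^sub>F y in at_right 0. \<phi> y \<le> 0"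
    using arcs by eventually_elim (metis return_arc.x1_nonpos)
  have \<alpha>0: "fps_nth \<alpha> 0 = 0"
  proof -
    have "\<forall>\<^sub>F z in nhds 0. eval_fps \<alpha> z = \<phi> z"
      using \<phi>(1) by (simp add: has_fps_expansion_def)
    then have "eval_fps \<alpha> 0 = \<phi> 0" by (rule eventually_nhds_x_imp_x)
    then show ?thesis using \<phi>(2) by (simp add: eval_fps_at_0)
  qed
  have \<alpha>1: "fps_nth \<alpha> 1 \<le> 0"
  proof -
    obtain N where N: "N \<ge> 0" "\<forall>\<^sub>F x in nhds 0. \<bar>\<phi> x - (\<Sum>i<2. fps_nth \<alpha> i * x ^ i)\<bar> \<le> N * \<bar>x\<bar> ^ 2"
      by (rule has_fps_expansion_remainder[OF \<phi>(1), of 2])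
    from N(2) have "\<forall>\<^sub>F x in at_right 0. \<bar>\<phi> x - (\<Sum>i<2. fps_nth \<alpha> i * x ^ i)\<bar> \<le> N * \<bar>x\<bar> ^ 2"
      by (auto simp: at_within_def intro: filter_leD[OF inf_le1])
    then have "\<forall>\<^sub>F x in at_right 0. fps_nth \<alpha> 1 \<le> N * x"
      using nonpos le1
    proof eventually_elim
      case (elim x)
      then have "\<bar>\<phi> x - fps_nth \<alpha> 1 * x\<bar> \<le> N * x * x"
        by (simp add: numeral_2_eq_2 \<alpha>0)
      with elim(2) have "fps_nth \<alpha> 1 * x \<le> N * x * x" by linarith
      then show ?case using elim(3) mult_right_le_imp_le by blast
    qed
    moreover have "((\<lambda>x. N * x) \<longlongrightarrow> N * 0) (at_right 0)" by (intro tendsto_intros)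
    ultimately show ?thesis
      using tendsto_le[OF trivial_limit_at_right_real _ tendsto_const] by fastforce
  qed
  define PF where "PF U = fps_const (- q / (2 * real k)) * U ^ (2 * k)
      + fps_const (b1 / (2 * real k + 1)) * U ^ (2 * k + 1)
      + fps_const (b2 / (2 * real k + 2)) * U ^ (2 * k + 2)
      + fps_const (b3 / (2 * real k + 3)) * U ^ (2 * k + 3)" for U
  define QF where "QF U = fps_const (1 / 5) * U ^ 5 - fps_const (2 / 3) * (fps_X\<^sup>2 * U ^ 3)
      + fps_X ^ 4 * U" for U :: "real fps"
  have PF: "(\<lambda>y. P (\<psi> y)) has_fps_expansion PF U" if "\<psi> has_fps_expansion U" for \<psi> U
    unfolding P_def PF_def
    by (intro has_fps_expansion_add has_fps_expansion_mult has_fps_expansion_const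
        has_fps_expansion_pow that)
  have QF: "(\<lambda>y. Q y (\<psi> y)) has_fps_expansion QF U" if "\<psi> has_fps_expansion U" for \<psi> U
  proof -
    have "(\<lambda>y. 1 / 5 * \<psi> y ^ 5 - 2 / 3 * (y\<^sup>2 * \<psi> y ^ 3) + y ^ 4 * \<psi> y) has_fps_expansion QF U"
      unfolding QF_def
      by (intro has_fps_expansion_add has_fps_expansion_diff has_fps_expansion_mult
          has_fps_expansion_const has_fps_expansion_pow has_fps_expansion_fps_X that)
    then show ?thesis by (simp add: Q_def mult.assoc)
  qed
  define H where "H = PF \<alpha> - PF fps_X + fps_const \<theta> * (QF \<alpha> - QF fps_X)"
  have "(\<lambda>y. P (\<phi> y) - P y + \<theta> * (Q y (\<phi> y) - Q y y)) has_fps_expansion H"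
    unfolding H_def
    by (intro has_fps_expansion_add has_fps_expansion_diff has_fps_expansion_mult
        has_fps_expansion_const PF QF \<phi> has_fps_expansion_fps_X)
  from fps_nth_eq_0_if_bounded[OF this bound] have zero: "fps_nth H m = 0" if "m < 2 * k + 4" for m
    using that .
  have \<theta>0: "k = 1 \<or> \<theta> = 0" by (simp add: \<theta>_def)
  have "- q \<noteq> 0" using q by simp
  \<comment> \<open>Used with \<open>A = - q\<close> and p_i = b_i / (2k + i), so the factor
    \<open>2 * k + 2\<close> in the fourth coefficient cancels.\<close>
  note R = return_series_coeffs[OF k this \<alpha>0 \<alpha>1 \<theta>0 zero[unfolded H_def PF_def QF_def]]
  show "fps_nth \<alpha> 1 = -1" by (rule R)
  show "fps_nth \<alpha> 2 = 2 * b1 / (q * (2 * real k + 1))" using R(2) by (simp add: mult.commute)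
  show "fps_nth \<alpha> 3 = - (fps_nth \<alpha> 2)\<^sup>2" by (rule R)
  have "(2 * real k + 2) * (b2 / (2 * real k + 2)) = b2" by simp
  with R(4) show "fps_nth \<alpha> 4 = (2 * (real k)\<^sup>2 + 3 * real k + 7) / 6 * fps_nth \<alpha> 2 ^ 3
      + b2 * fps_nth \<alpha> 2 / q + 2 * b3 / (q * (2 * real k + 3)) + 16 * \<theta> / (15 * q)"
    by (simp add: mult.commute)
qed

end

section \<open>Half-return maps of vector fields\<close>

lemma has_power_series2_tendsto:
  assumes "has_power_series2 h (0, 0) c"
  shows "(h \<longlongrightarrow> h (0, 0)) (nhds (0, 0))"
proof -
  obtain M r where M: "M \<ge> 0" "r > 0"
    "\<And>u v. \<bar>u\<bar> < r \<Longrightarrow> \<bar>v\<bar> < r \<Longrightarrow>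
      \<bar>h (u, v) - (c 0 0 + c 1 0 * u + c 2 0 * u\<^sup>2 + c 0 1 * v)\<bar>
        \<le> M * (\<bar>u\<bar> ^ 3 + \<bar>u\<bar> * \<bar>v\<bar> + v\<^sup>2)"
    using has_power_series2_remainder[OF assms] by metis
  have h0: "h (0, 0) = c 0 0" using M(3)[of 0 0] M(2) by simp
  let ?b = "\<lambda>p. \<bar>c 1 0 * fst p + c 2 0 * (fst p)\<^sup>2 + c 0 1 * snd p\<bar>
    + M * (\<bar>fst p\<bar> ^ 3 + \<bar>fst p\<bar> * \<bar>snd p\<bar> + (snd p)\<^sup>2)"
  have "((\<lambda>p. h p - h (0, 0)) \<longlongrightarrow> 0) (nhds (0, 0))"
  proof (rule Lim_null_comparison)
    have "open ({- r<..<r} \<times> {- r<..<r})" by (intro open_Times) auto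
    then have "\<forall>\<^sub>F p in nhds (0, 0). p \<in> {- r<..<r} \<times> {- r<..<r}"
      using M(2) by (intro eventually_nhds_in_open) auto
    then show "\<forall>\<^sub>F p in nhds (0, 0). norm (h p - h (0, 0)) \<le> ?b p"
    proof eventually_elim
      case (elim p)
      obtain u v where p: "p = (u, v)" by (cases p)
      with elim have "\<bar>u\<bar> < r" "\<bar>v\<bar> < r" by auto
      from M(3)[OF this] show ?case unfolding p h0 real_norm_def fst_conv snd_conv by linarith
    qed
    have id: "((\<lambda>p. p) \<longlongrightarrow> (0 :: real, 0 :: real)) (nhds (0, 0))" by (rule filterlim_ident)
    have fs: "(fst \<longlongrightarrow> (0 :: real)) (nhds (0 :: real, 0 :: real))"
      "(snd \<longlongrightarrow> (0 :: real)) (nhds (0 :: real, 0 :: real))"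
      using tendsto_fst[OF id] tendsto_snd[OF id] by simp_all
    have "(?b \<longlongrightarrow> \<bar>c 1 0 * 0 + c 2 0 * 0\<^sup>2 + c 0 1 * 0\<bar> + M * (\<bar>0\<bar> ^ 3 + \<bar>0\<bar> * \<bar>0\<bar> + 0\<^sup>2)) (nhds (0, 0))"
      by (intro tendsto_intros fs)
    then show "(?b \<longlongrightarrow> 0) (nhds (0, 0))" by simp
  qed
  then show ?thesis by (rule LIM_zero_cancel)
qed

lemma eventually_nhds_box:
  fixes Pr :: "real \<times> real \<Rightarrow> bool"
  assumes "\<forall>\<^sub>F p in nhds (0, 0). Pr p"
  obtains \<rho> where "\<rho> > 0" "\<And>u v. \<bar>u\<bar> < \<rho> \<Longrightarrow> \<bar>v\<bar> < \<rho> \<Longrightarrow> Pr (u, v)"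
proof -
  obtain e where e: "e > 0" "\<And>p. dist p (0, 0) < e \<Longrightarrow> Pr p"
    using assms by (auto simp: eventually_nhds_metric)
  have "Pr (u, v)" if "\<bar>u\<bar> < e / 2" "\<bar>v\<bar> < e / 2" for u v
    using that norm_Pair_le[of u v] by (intro e(2)) (simp add: dist_norm)
  with e(1) show ?thesis by (intro that[of "e / 2"]) auto
qed

lemma pm_cases: "pm s = 1 \<or> pm s = - 1"
  by (cases s) auto

text \<open>Rescaling time by \<open>T\<close> treats forward and backward orbits alike; the
  direction survives as the sign of the factor \<open>T\<close>.\<close>

lemma half_return_point_unit_time:
  assumes "half_return_point s V x x'"
  obtains T \<gamma> where "T \<noteq> 0" "\<gamma> 0 = (x, 0)" "\<gamma> 1 = (x', 0)"
    "\<And>t. t \<in> {0..1} \<Longrightarrow> (\<gamma> has_vector_derivative T *\<^sub>R V (\<gamma> t)) (at t within {0..1})"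
    "\<And>t. 0 < t \<Longrightarrow> t < 1 \<Longrightarrow> pm s * snd (\<gamma> t) > 0"
proof -
  obtain T \<gamma> where T: "T \<noteq> 0" "\<gamma> 0 = (x, 0)" "\<gamma> T = (x', 0)"
    "\<And>t. t \<in> closed_segment 0 T \<Longrightarrow> (\<gamma> has_vector_derivative V (\<gamma> t)) (at t within closed_segment 0 T)"
    "\<And>t. t \<in> open_segment 0 T \<Longrightarrow> pm s * snd (\<gamma> t) > 0"
    using assms unfolding half_return_point_def by blast
  have img: "(\<lambda>t. t * T) ` {0..1} = closed_segment 0 T"
    by (simp add: closed_segment_image_interval)
  have "((\<gamma> \<circ> (\<lambda>t. t * T)) has_vector_derivative T *\<^sub>R V (\<gamma> (t * T))) (at t within {0..1})"
    if "t \<in> {0..1}" for t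
  proof (rule vector_diff_chain_within)
    show "((\<lambda>t. t * T) has_vector_derivative T) (at t within {0..1})"
      unfolding has_real_derivative_iff_has_vector_derivative[symmetric]
      by (auto intro!: derivative_eq_intros)
    show "(\<gamma> has_vector_derivative V (\<gamma> (t * T))) (at (t * T) within (\<lambda>t. t * T) ` {0..1})"
      unfolding img using that img by (intro T) blast
  qed
  moreover have "pm s * snd (\<gamma> (t * T)) > 0" if "0 < t" "t < 1" for t
    using that T(1) by (intro T(5)) (auto simp: in_segment)
  ultimately show ?thesis
    using T by (intro that[of T "\<gamma> \<circ> (\<lambda>t. t * T)"]) auto
qed

text \<open>The quotients defining \<open>f\<close> and \<open>g\<close> are solved for Y, which
  gives an identity valid on the axes too. The factor \<open>pm s * \<delta>\<close>, whose square
  is 1, is inserted twice around \<open>g\<close> to bring out the height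
  \<open>pm s * y\<close>.\<close>

lemma slope_near_origin:
  fixes V :: vfield
  assumes "analytic_field V" and k: "k > 0" and X0: "X_of V 0 0 \<noteq> 0" and Y0: "Y_of V 0 0 = 0"
    and \<delta>: "\<delta> = 1 \<or> \<delta> = - 1"
    and f: "\<forall>\<^sub>F x in at 0. f x = f_quot s \<delta> V k x"
    and g: "\<forall>\<^sub>F (x, y) in nhds (0, 0). y \<noteq> 0 \<longrightarrow> g (x, y) = g_quot s \<delta> V x y"
  obtains r where "r > 0"
    "\<And>x y. \<bar>x\<bar> < r \<Longrightarrow> \<bar>y\<bar> < r \<Longrightarrow> sgn (X_of V x y) = sgn (X_of V 0 0)"
    "\<And>x y. \<bar>x\<bar> < r \<Longrightarrow> \<bar>y\<bar> < r \<Longrightarrow> pm s * \<delta> * Y_of V x y =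
      X_of V x y * (a_of V k * x ^ (2 * k - 1) + x ^ (2 * k) * f x + pm s * \<delta> * y * (pm s * \<delta> * g (x, y)))"
proof -
  have "\<exists>c. has_power_series2 (\<lambda>p. fst (V p)) (0, 0) c"
    using assms(1) unfolding analytic_field_def analytic2_near_def
    by (blast dest: eventually_nhds_x_imp_x)
  then have "((\<lambda>p. fst (V p)) \<longlongrightarrow> X_of V 0 0) (nhds (0, 0))"
    unfolding X_of_def using has_power_series2_tendsto by blast
  then have "\<forall>\<^sub>F p in nhds (0, 0). dist (fst (V p)) (X_of V 0 0) < \<bar>X_of V 0 0\<bar>"
    using X0 by (intro tendstoD) auto
  then obtain r1 where r1: "r1 > 0"
    "\<And>x y. \<bar>x\<bar> < r1 \<Longrightarrow> \<bar>y\<bar> < r1 \<Longrightarrow> dist (X_of V x y) (X_of V 0 0) < \<bar>X_of V 0 0\<bar>"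
    by (rule eventually_nhds_box) (auto simp: X_of_def)
  obtain r2 where r2: "r2 > 0"
    "\<And>x y. \<bar>x\<bar> < r2 \<Longrightarrow> \<bar>y\<bar> < r2 \<Longrightarrow> y \<noteq> 0 \<longrightarrow> g (x, y) = g_quot s \<delta> V x y"
    using g by (rule eventually_nhds_box) auto
  obtain r3 where r3: "r3 > 0" "\<And>x. x \<noteq> 0 \<Longrightarrow> \<bar>x\<bar> < r3 \<Longrightarrow> f x = f_quot s \<delta> V k x"
    using f by (auto simp: eventually_at dist_real_def)
  define r where "r = min r1 (min r2 r3)"
  have sgn: "sgn (X_of V x y) = sgn (X_of V 0 0)" if "\<bar>x\<bar> < r" "\<bar>y\<bar> < r" for x y
    using r1(2)[of x y] that by (auto simp: r_def dist_real_def sgn_real_def split: if_splits)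
  have nz: "X_of V x y \<noteq> 0" if "\<bar>x\<bar> < r" "\<bar>y\<bar> < r" for x y
    using sgn[OF that] X0 by (metis sgn_zero_iff)
  have r0: "r > 0" using r1 r2 r3 by (simp add: r_def)
  have sq: "pm s * pm s = 1" "\<delta> * \<delta> = 1" using \<delta> by (cases s; auto)+
  \<comment> \<open>At \<open>x = 0\<close> the quotient says nothing, but both sides vanish, since
    \<open>2 * k - 1\<close> is positive.\<close>
  have axis: "pm s * \<delta> * Y_of V x 0 = X_of V x 0 * (a_of V k * x ^ (2 * k - 1) + x ^ (2 * k) * f x)"
    if x: "\<bar>x\<bar> < r" for x
  proof (cases "x = 0")
    case True
    then show ?thesis using Y0 k by (simp add: power_0_left)
  next
    case False
    then have "f x = f_quot s \<delta> V k x" using r3(2) x by (simp add: r_def)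
    then show ?thesis using False nz[OF x] r0 by (simp add: f_quot_def field_simps)
  qed
  have main: "pm s * \<delta> * Y_of V x y =
      X_of V x y * (a_of V k * x ^ (2 * k - 1) + x ^ (2 * k) * f x + pm s * \<delta> * y * (pm s * \<delta> * g (x, y)))"
    if xy: "\<bar>x\<bar> < r" "\<bar>y\<bar> < r" for x y
  proof (cases "y = 0")
    case True
    then show ?thesis using axis[OF xy(1)] by simp
  next
    case False
    then have g: "g (x, y) = g_quot s \<delta> V x y" using r2(2) xy by (simp add: r_def)
    have nz2: "X_of V x 0 \<noteq> 0" "X_of V x y \<noteq> 0" "\<delta> \<noteq> 0" using nz xy r0 \<delta> by auto
    have "X_of V x y * (y * g (x, y)) =
        pm s * \<delta> * (Y_of V x y - X_of V x y * (Y_of V x 0 / X_of V x 0))"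
      using False nz2 \<delta> unfolding g g_quot_def by (auto simp: field_simps)
    also have "\<dots> = pm s * \<delta> * Y_of V x y - X_of V x y * ((pm s * \<delta> * Y_of V x 0) / X_of V x 0)"
      by (simp add: algebra_simps)
    also have "(pm s * \<delta> * Y_of V x 0) / X_of V x 0 = a_of V k * x ^ (2 * k - 1) + x ^ (2 * k) * f x"
      using axis[OF xy(1)] nz2 by simp
    finally have "pm s * \<delta> * Y_of V x y = X_of V x y * (a_of V k * x ^ (2 * k - 1) + x ^ (2 * k) * f x)
      + X_of V x y * (y * g (x, y))" by simp
    moreover have "pm s * \<delta> * y * (pm s * \<delta> * g (x, y)) = (pm s * pm s) * (\<delta> * \<delta>) * (y * g (x, y))"
      by (simp only: mult_ac)
    ultimately show ?thesis using sq by (simp add: distrib_left)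
  qed
  show ?thesis by (rule that[OF r0 sgn main])
qed

text \<open>The passage to the height multiplies \<open>a\<close> and \<open>f\<close> by \<delta>,
  and \<open>g\<close> by \<open>pm s * \<delta>\<close>; the abbreviations are the resulting Taylor
  data of the common slope field.\<close>

lemma half_return_coeffs:
  fixes V :: vfield
  assumes an: "analytic_field V" and k: "k > 0" and X0: "X_of V 0 0 \<noteq> 0" and Y0: "Y_of V 0 0 = 0"
    and \<delta>: "\<delta> = 1 \<or> \<delta> = - 1" and invisible: "\<delta> * a_of V k < 0"
    and f: "f_expansion s \<delta> V k F" and g: "g_expansion s \<delta> V Gc"
    and \<phi>: "half_return_map s V \<phi>" "\<phi> has_fps_expansion \<alpha>"
  defines "A \<equiv> \<delta> * a_of V k"
    and "f0 \<equiv> \<delta> * fps_nth F 0" and "f1 \<equiv> \<delta> * fps_nth F 1" and "f2 \<equiv> \<delta> * fps_nth F 2"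
    and "c0 \<equiv> pm s * \<delta> * Gc 0 0" and "c1 \<equiv> pm s * \<delta> * Gc 1 0" and "c2 \<equiv> pm s * \<delta> * Gc 2 0"
  shows "fps_nth \<alpha> 1 = -1"
    and "fps_nth \<alpha> 2 = - 2 * (f0 - c0 * A) / (A * (2 * real k + 1))"
    and "fps_nth \<alpha> 3 = - (fps_nth \<alpha> 2)\<^sup>2"
    and "fps_nth \<alpha> 4 = (2 * (real k)\<^sup>2 + 3 * real k + 7) / 6 * fps_nth \<alpha> 2 ^ 3
      - (f1 - c0 * f0 + (c0\<^sup>2 - c1) / 2 * A) * fps_nth \<alpha> 2 / A
      - 2 * (f2 - c0 * f1 + (c0\<^sup>2 - c1) / 2 * f0 + (- c2 / 3 + c0 * c1 / 2 - c0 ^ 3 / 6) * A)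
          / (A * (2 * real k + 3))
      + (if k = 1 then - 4 * (\<delta> * Gc 0 1) * A / 15 else 0)"
proof -
  define \<sigma> where "\<sigma> = pm s"
  have \<sigma>: "\<sigma> = 1 \<or> \<sigma> = -1" by (auto simp: \<sigma>_def pm_cases)
  have abs1: "\<bar>\<sigma>\<bar> = 1" "\<bar>\<delta>\<bar> = 1" "\<sigma> * \<sigma> = 1" "\<delta> * \<delta> = 1" using \<sigma> \<delta> by auto
  obtain fx where fx: "\<forall>\<^sub>F x in at 0. fx x = f_quot s \<delta> V k x" "fx has_fps_expansion F"
    using f by (auto simp: f_expansion_def)
  obtain gx where gx: "\<forall>\<^sub>F (x, y) in nhds (0, 0). y \<noteq> 0 \<longrightarrow> gx (x, y) = g_quot s \<delta> V x y"
    "has_power_series2 gx (0, 0) Gc"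
    using g by (auto simp: g_expansion_def)
  obtain r1 where r1: "r1 > 0"
    "\<And>x y. \<bar>x\<bar> < r1 \<Longrightarrow> \<bar>y\<bar> < r1 \<Longrightarrow> sgn (X_of V x y) = sgn (X_of V 0 0)"
    "\<And>x y. \<bar>x\<bar> < r1 \<Longrightarrow> \<bar>y\<bar> < r1 \<Longrightarrow> \<sigma> * \<delta> * Y_of V x y =
      X_of V x y * (a_of V k * x ^ (2 * k - 1) + x ^ (2 * k) * fx x + \<sigma> * \<delta> * y * (\<sigma> * \<delta> * gx (x, y)))"
    using slope_near_origin[OF an k X0 Y0 \<delta> fx(1) gx(1)] unfolding \<sigma>_def by metis
  obtain M2 where M2: "M2 \<ge> 0"
    "\<forall>\<^sub>F x in nhds 0. \<bar>fx x - (\<Sum>i<3. fps_nth F i * x ^ i)\<bar> \<le> M2 * \<bar>x\<bar> ^ 3"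
    by (rule has_fps_expansion_remainder[OF fx(2), of 3])
  then obtain r2 where r2: "r2 > 0"
    "\<And>x. \<bar>x\<bar> < r2 \<Longrightarrow> \<bar>fx x - (\<Sum>i<3. fps_nth F i * x ^ i)\<bar> \<le> M2 * \<bar>x\<bar> ^ 3"
    by (auto simp: eventually_nhds_metric)
  obtain M3 r3 where r3: "M3 \<ge> 0" "r3 > 0"
    "\<And>u v. \<bar>u\<bar> < r3 \<Longrightarrow> \<bar>v\<bar> < r3 \<Longrightarrow>
      \<bar>gx (u, v) - (Gc 0 0 + Gc 1 0 * u + Gc 2 0 * u\<^sup>2 + Gc 0 1 * v)\<bar>
        \<le> M3 * (\<bar>u\<bar> ^ 3 + \<bar>u\<bar> * \<bar>v\<bar> + v\<^sup>2)"
    using has_power_series2_remainder[OF gx(2)] by blast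
  define r where "r = min 1 (min r1 (min r2 r3))"
  have rad: "r > 0" "r \<le> 1" "r \<le> r1" "r \<le> r2" "r \<le> r3" using r1 r2 r3 by (auto simp: r_def)
  \<comment> \<open>Besides the sign \<open>pm s\<close> of \<open>g\<close> there is another from
    \<open>y = pm s * p\<close>; the two cancel.\<close>
  define d where "d = \<delta> * Gc 0 1"
  define M where "M = (\<bar>f0\<bar> + \<bar>f1\<bar> + \<bar>f2\<bar> + M2) + (\<bar>c0\<bar> + \<bar>c1\<bar> + \<bar>c2\<bar> + \<bar>d\<bar> + 3 * M3)"
  have M: "M \<ge> 0" "M2 \<le> M" "M3 \<le> M" using M2 r3 by (auto simp: M_def)
  define q where "q = - A"
  have q: "q > 0" using invisible by (simp add: q_def A_def)
  define Ff where "Ff x = \<delta> * fx x" for x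
  define Gf where "Gf x p = \<sigma> * \<delta> * gx (x, \<sigma> * p)" for x p
  have Ff: "\<bar>Ff u - (f0 + f1 * u + f2 * u\<^sup>2)\<bar> \<le> M2 * \<bar>u\<bar> ^ 3" if "\<bar>u\<bar> < r" for u
  proof -
    have "Ff u - (f0 + f1 * u + f2 * u\<^sup>2) = \<delta> * (fx u - (\<Sum>i<3. fps_nth F i * u ^ i))"
      by (simp add: Ff_def f0_def f1_def f2_def numeral_eq_Suc algebra_simps)
    then show ?thesis using r2(2)[of u] that rad by (simp only: abs_mult abs1) simp
  qed
  have Gf: "\<bar>Gf u v - (c0 + c1 * u + c2 * u\<^sup>2 + d * v)\<bar> \<le> M3 * (\<bar>u\<bar> ^ 3 + \<bar>u\<bar> * \<bar>v\<bar> + v\<^sup>2)"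
    if "\<bar>u\<bar> < r" "\<bar>v\<bar> < r" for u v
  proof -
    have "d * v = (\<sigma> * \<sigma>) * d * v" by (simp add: abs1)
    then have "Gf u v - (c0 + c1 * u + c2 * u\<^sup>2 + d * v)
        = \<sigma> * \<delta> * (gx (u, \<sigma> * v) - (Gc 0 0 + Gc 1 0 * u + Gc 2 0 * u\<^sup>2 + Gc 0 1 * (\<sigma> * v)))"
      by (simp add: Gf_def c0_def c1_def c2_def d_def \<sigma>_def algebra_simps)
    moreover have "\<bar>\<sigma> * v\<bar> = \<bar>v\<bar>" "(\<sigma> * v)\<^sup>2 = v\<^sup>2" using \<sigma> by auto
    ultimately show ?thesis using r3(3)[of u "\<sigma> * v"] that rad by (simp only: abs_mult abs1) simp
  qed
  have small_pow: "\<bar>u\<bar> ^ n \<le> 1" if "\<bar>u\<bar> < r" for u :: real and n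
    using that rad by (intro power_le_one) auto
  interpret slope_jet k q M r Ff Gf f0 f1 f2 c0 c1 c2 d
  proof
    show "k \<ge> 1" "q > 0" "M \<ge> 0" "r > 0" using k q M rad by auto
    show "\<bar>Ff u - (f0 + f1 * u + f2 * u\<^sup>2)\<bar> \<le> M * \<bar>u\<bar> ^ 3" if "\<bar>u\<bar> < r" for u
      using Ff[OF that] M mult_right_mono[OF M(2), of "\<bar>u\<bar> ^ 3"] by simp
    show "\<bar>Gf u v - (c0 + c1 * u + c2 * u\<^sup>2 + d * v)\<bar> \<le> M * (\<bar>u\<bar> ^ 3 + \<bar>u\<bar> * \<bar>v\<bar> + v\<^sup>2)"
      if "\<bar>u\<bar> < r" "\<bar>v\<bar> < r" for u v
      using Gf[OF that] mult_right_mono[OF M(3), of "\<bar>u\<bar> ^ 3 + \<bar>u\<bar> * \<bar>v\<bar> + v\<^sup>2"] by simp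
    have le: "\<bar>c * u\<bar> \<le> \<bar>c\<bar>" if "\<bar>u\<bar> \<le> 1" for c u :: real
      using that mult_left_mono[of "\<bar>u\<bar>" 1 "\<bar>c\<bar>"] by (simp add: abs_mult)
    show "\<bar>Ff u\<bar> \<le> M" if u: "\<bar>u\<bar> < r" for u
    proof -
      have "M2 * \<bar>u\<bar> ^ 3 \<le> M2" using small_pow[OF u, of 3] M2(1) by (simp add: mult_left_le)
      with Ff[OF u] have *: "\<bar>Ff u - (f0 + f1 * u + f2 * u\<^sup>2)\<bar> \<le> M2" by (rule order_trans)
      have "\<bar>Ff u\<bar> \<le> \<bar>f0\<bar> + \<bar>f1 * u\<bar> + \<bar>f2 * u\<^sup>2\<bar> + \<bar>Ff u - (f0 + f1 * u + f2 * u\<^sup>2)\<bar>"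
        by linarith
      also have "\<dots> \<le> \<bar>f0\<bar> + \<bar>f1\<bar> + \<bar>f2\<bar> + M2"
        using small_pow[OF u, of 1] small_pow[OF u, of 2] by (intro add_mono le * order_refl) simp_all
      also have "\<dots> \<le> M" using r3(1) by (simp add: M_def)
      finally show ?thesis .
    qed
    show "\<bar>Gf u v\<bar> \<le> M" if u: "\<bar>u\<bar> < r" and v: "\<bar>v\<bar> < r" for u v
    proof -
      have "\<bar>u\<bar> * \<bar>v\<bar> \<le> 1 * 1" using u v rad by (intro mult_mono) auto
      moreover have "v\<^sup>2 \<le> 1" using small_pow[OF v, of 2] by simp
      ultimately have "M3 * (\<bar>u\<bar> ^ 3 + \<bar>u\<bar> * \<bar>v\<bar> + v\<^sup>2) \<le> M3 * 3"
        using small_pow[OF u, of 3] r3(1) by (intro mult_left_mono) auto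
      then have *: "\<bar>Gf u v - (c0 + c1 * u + c2 * u\<^sup>2 + d * v)\<bar> \<le> 3 * M3"
        using Gf[OF u v] by simp
      have "\<bar>Gf u v\<bar> \<le> \<bar>c0\<bar> + \<bar>c1 * u\<bar> + \<bar>c2 * u\<^sup>2\<bar> + \<bar>d * v\<bar>
          + \<bar>Gf u v - (c0 + c1 * u + c2 * u\<^sup>2 + d * v)\<bar>"
        by linarith
      also have "\<dots> \<le> \<bar>c0\<bar> + \<bar>c1\<bar> + \<bar>c2\<bar> + \<bar>d\<bar> + 3 * M3"
        using small_pow[OF u, of 1] small_pow[OF u, of 2] small_pow[OF v, of 1]
        by (intro add_mono le * order_refl) simp_all
      also have "\<dots> \<le> M" using M2(1) by (simp add: M_def)
      finally show ?thesis .
    qed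
  qed
  have slope: "\<sigma> * Y_of V x y = X_of V x y * slope x (\<sigma> * y)" if "\<bar>x\<bar> < r" "\<bar>y\<bar> < r" for x y
  proof -
    have xy: "\<bar>x\<bar> < r1" "\<bar>y\<bar> < r1" using that rad(3) by auto
    have y: "\<sigma> * (\<sigma> * y) = y" using \<sigma> by auto
    have "\<sigma> * Y_of V x y = \<delta> * (\<sigma> * \<delta> * Y_of V x y)" using \<delta> by auto
    also have "\<dots> = X_of V x y * (\<delta> * a_of V k * x ^ (2 * k - 1) + x ^ (2 * k) * (\<delta> * fx x)
        + (\<delta> * \<delta>) * (\<sigma> * y) * (\<sigma> * \<delta> * gx (x, y)))"
      unfolding r1(3)[OF xy] by (simp add: algebra_simps)
    finally show ?thesis
      unfolding slope_def unfolding Gf_def Ff_def y q_def A_def abs1 by simp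
  qed
  have smallness: "\<forall>\<^sub>F y in at_right 0. 0 < y \<and> D * y < r / 2 \<and> B * y ^ (2 * k) < r / 2 \<and> D * y * M < q"
  proof -
    have "((\<lambda>y. D * y) \<longlongrightarrow> D * 0) (at_right 0)" by (intro tendsto_intros)
    then have 1: "\<forall>\<^sub>F y in at_right 0. D * y < r / 2"
      by (rule order_tendstoD(2)) (use rad in simp)
    have "((\<lambda>y. B * y ^ (2 * k)) \<longlongrightarrow> B * 0 ^ (2 * k)) (at_right 0)" by (intro tendsto_intros)
    then have 2: "\<forall>\<^sub>F y in at_right 0. B * y ^ (2 * k) < r / 2"
      by (rule order_tendstoD(2)) (use rad k in \<open>simp add: power_0_left\<close>)
    have "((\<lambda>y. D * y * M) \<longlongrightarrow> D * 0 * M) (at_right 0)" by (intro tendsto_intros)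
    then have 3: "\<forall>\<^sub>F y in at_right 0. D * y * M < q"
      by (rule order_tendstoD(2)) (use q in simp)
    from 1 2 3 eventually_at_right_less[of "0::real"] show ?thesis
      by eventually_elim blast
  qed
  have arcs: "\<forall>\<^sub>F y in at_right 0. \<exists>s' x p \<tau>. return_arc k q M r Ff Gf s' x p \<tau> \<and> x 0 = y \<and> x 1 = \<phi> y"
  proof -
    have "\<forall>\<^sub>F y in at_right 0. half_return_point s V y (\<phi> y)"
      using \<phi>(1) by (auto simp: half_return_map_def eventually_at_split)
    then show ?thesis using smallness
    proof eventually_elim
      case (elim y)
      obtain T \<gamma> where T: "T \<noteq> 0" "\<gamma> 0 = (y, 0)" "\<gamma> 1 = (\<phi> y, 0)"
        "\<And>t. t \<in> {0..1} \<Longrightarrow> (\<gamma> has_vector_derivative T *\<^sub>R V (\<gamma> t)) (at t within {0..1})"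
        "\<And>t. 0 < t \<Longrightarrow> t < 1 \<Longrightarrow> pm s * snd (\<gamma> t) > 0"
        using half_return_point_unit_time[OF elim(1)] by metis
      define x where "x t = fst (\<gamma> t)" for t
      define p where "p t = \<sigma> * snd (\<gamma> t)" for t
      define \<tau> where "\<tau> t = T * X_of V (fst (\<gamma> t)) (snd (\<gamma> t))" for t
      have dx: "(x has_real_derivative \<tau> t) (at t within {0..1})" if "t \<in> {0..1}" for t
        using bounded_linear.has_vector_derivative[OF bounded_linear_fst T(4)[OF that]]
        by (simp add: has_real_derivative_iff_has_vector_derivative x_def[abs_def] \<tau>_def X_of_def)
      have "((\<lambda>t. snd (\<gamma> t)) has_real_derivative T * Y_of V (fst (\<gamma> t)) (snd (\<gamma> t))) (at t within {0..1})"
        if "t \<in> {0..1}" for t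
        using bounded_linear.has_vector_derivative[OF bounded_linear_snd T(4)[OF that]]
        by (simp add: has_real_derivative_iff_has_vector_derivative Y_of_def)
      then have dp: "(p has_real_derivative \<sigma> * (T * Y_of V (fst (\<gamma> t)) (snd (\<gamma> t)))) (at t within {0..1})"
        if "t \<in> {0..1}" for t
        unfolding p_def[abs_def] using that by (intro DERIV_cmult)
      have abs_p: "\<bar>p t\<bar> = \<bar>snd (\<gamma> t)\<bar>" for t by (simp add: p_def abs_mult abs1)
      \<comment> \<open>Near the origin X keeps its sign, so this product is the direction of x in
        rescaled time.\<close>
      have "return_arc k q M r Ff Gf (sgn T * sgn (X_of V 0 0)) x p \<tau>"
      proof
        show "sgn T * sgn (X_of V 0 0) = 1 \<or> sgn T * sgn (X_of V 0 0) = - 1"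
          using T(1) X0 by (auto simp: sgn_real_def)
        show "(x has_real_derivative \<tau> t) (at t within {0..1})" if "t \<in> {0..1}" for t
          by (rule dx[OF that])
        show "0 < sgn T * sgn (X_of V 0 0) * \<tau> t" if "t \<in> {0..1}" "\<bar>x t\<bar> < r" "\<bar>p t\<bar> < r" for t
        proof -
          have X: "sgn (X_of V (fst (\<gamma> t)) (snd (\<gamma> t))) = sgn (X_of V 0 0)"
            using that rad unfolding abs_p x_def by (intro r1(2)) auto
          then have "\<tau> t \<noteq> 0"
            using T(1) X0 unfolding \<tau>_def by (metis mult_eq_0_iff sgn_zero_iff)
          have "sgn T * sgn (X_of V 0 0) = sgn (\<tau> t)"
            unfolding \<tau>_def sgn_mult X ..
          with \<open>\<tau> t \<noteq> 0\<close> show ?thesis by (simp add: sgn_mult_self_eq sgn_real_def)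
        qed
        show "(p has_real_derivative \<tau> t * slope (x t) (p t)) (at t within {0..1})"
          if "t \<in> {0..1}" "\<bar>x t\<bar> < r" "\<bar>p t\<bar> < r" for t
        proof -
          have "\<sigma> * Y_of V (fst (\<gamma> t)) (snd (\<gamma> t)) = X_of V (fst (\<gamma> t)) (snd (\<gamma> t)) * slope (x t) (p t)"
            using slope[of "fst (\<gamma> t)" "snd (\<gamma> t)"] that(2,3) unfolding abs_p unfolding x_def p_def by simp
          then have "\<sigma> * (T * Y_of V (fst (\<gamma> t)) (snd (\<gamma> t))) = \<tau> t * slope (x t) (p t)"
            by (simp add: \<tau>_def mult.left_commute mult.assoc)
          with dp[OF that(1)] show ?thesis by simp
        qed
        show "continuous_on {0..1} p" by (rule DERIV_continuous_on[OF dp])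
        show "p 0 = 0" "p 1 = 0" by (simp_all add: p_def T)
        show "0 < p t" if "0 < t" "t < 1" for t using T(5)[OF that] by (simp add: p_def \<sigma>_def)
        show "0 < x 0" "D * x 0 < r / 2" "B * x 0 ^ (2 * k) < r / 2" "D * x 0 * M < q"
          using elim(2) by (simp_all add: x_def T)
      qed
      moreover have "x 0 = y" "x 1 = \<phi> y" by (simp_all add: x_def T)
      ultimately show ?case by blast
    qed
  qed
  have "\<phi> 0 = 0" using \<phi>(1) by (simp add: half_return_map_def)
  note R = return_map_coeffs[OF \<phi>(2) this arcs]
  have A: "A = - q" by (simp add: q_def)
  have b: "b1 = f0 - c0 * A" "b2 = f1 - c0 * f0 + (c0\<^sup>2 - c1) / 2 * A"
    "b3 = f2 - c0 * f1 + (c0\<^sup>2 - c1) / 2 * f0 + (- c2 / 3 + c0 * c1 / 2 - c0 ^ 3 / 6) * A"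
    unfolding b1_def b2_def b3_def E1_def E2_def E3_def A by simp_all
  have neg: "y / (q * z) = - y / (A * z)" for y z
    unfolding A by simp
  show "fps_nth \<alpha> 1 = -1" by (rule R)
  show "fps_nth \<alpha> 2 = - 2 * (f0 - c0 * A) / (A * (2 * real k + 1))"
    using R(2) unfolding neg b by (simp only: mult_minus_left)
  show "fps_nth \<alpha> 3 = - (fps_nth \<alpha> 2)\<^sup>2" by (rule R)
  have "16 * \<theta> / (15 * q) = (if k = 1 then - 4 * (\<delta> * Gc 0 1) * A / 15 else 0)"
    using q unfolding \<theta>_def unfolding A d_def by (simp add: power2_eq_square)
  with R(4) show "fps_nth \<alpha> 4 = (2 * (real k)\<^sup>2 + 3 * real k + 7) / 6 * fps_nth \<alpha> 2 ^ 3
      - (f1 - c0 * f0 + (c0\<^sup>2 - c1) / 2 * A) * fps_nth \<alpha> 2 / A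
      - 2 * (f2 - c0 * f1 + (c0\<^sup>2 - c1) / 2 * f0 + (- c2 / 3 + c0 * c1 / 2 - c0 ^ 3 / 6) * A)
          / (A * (2 * real k + 3))
      + (if k = 1 then - 4 * (\<delta> * Gc 0 1) * A / 15 else 0)"
    unfolding neg neg[of _ 1, unfolded mult_1_right] b
    by (simp only: minus_divide_left[symmetric] diff_conv_add_uminus)
qed

section \<open>Normalization of signs and the final formulas\<close>

lemma normalize_signs:
  fixes \<sigma> \<delta> a \<kappa> \<alpha>2 f0 f1 f2 g00 g10 g20 :: real
  assumes \<sigma>: "\<sigma> = 1 \<or> \<sigma> = -1" and \<delta>: "\<delta> = 1 \<or> \<delta> = -1" and a: "a \<noteq> 0" and \<kappa>: "\<kappa> > 0"
    and \<alpha>2: "\<alpha>2 = - 2 * (\<delta> * f0 - \<sigma> * \<delta> * g00 * (\<delta> * a)) / (\<delta> * a * (2 * \<kappa> + 1))"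
  shows "\<alpha>2 = (- 2 * f0 + \<sigma> * 2 * \<delta> * a * g00) / (2 * a * \<kappa> + a)"
    and "(2 * \<kappa>\<^sup>2 + 3 * \<kappa> + 7) / 6 * \<alpha>2 ^ 3 =
      4 * (\<kappa> * (2 * \<kappa> + 3) + 7) * (- f0 + \<sigma> * \<delta> * a * g00) ^ 3 / (3 * a ^ 3 * (2 * \<kappa> + 1) ^ 3)"
    and "(\<delta> * f1 - \<sigma> * \<delta> * g00 * (\<delta> * f0) + ((\<sigma> * \<delta> * g00)\<^sup>2 - \<sigma> * \<delta> * g10) / 2 * (\<delta> * a)) * \<alpha>2 / (\<delta> * a) =
      \<sigma> * (12 * \<delta> * a * (f0 - \<sigma> * \<delta> * a * g00)
        * (a * (g10 - \<sigma> * \<delta> * g00\<^sup>2) + 2 * f0 * g00 - \<sigma> * 2 * \<delta> * f1) / (3 * a ^ 3 * (8 * \<kappa> + 4)))"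
    and "2 * (\<delta> * f2 - \<sigma> * \<delta> * g00 * (\<delta> * f1) + ((\<sigma> * \<delta> * g00)\<^sup>2 - \<sigma> * \<delta> * g10) / 2 * (\<delta> * f0)
          + (- (\<sigma> * \<delta> * g20) / 3 + \<sigma> * \<delta> * g00 * (\<sigma> * \<delta> * g10) / 2 - (\<sigma> * \<delta> * g00) ^ 3 / 6) * (\<delta> * a))
        / (\<delta> * a * (2 * \<kappa> + 3)) =
      - (\<sigma> * (4 * \<delta> * a\<^sup>2 * (a * (2 * g20 + g00 ^ 3) + 6 * g00 * f1 + 3 * f0 * g10
          - \<sigma> * 3 * \<delta> * (a * g10 * g00 + f0 * g00\<^sup>2 + 2 * f2)) / (3 * a ^ 3 * (8 * \<kappa> + 12))))"
proof -
  \<comment> \<open>Naming the two odd factors makes them nonzero atoms for clearing denominators;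
    the rest is a check over the signs \<sigma> and \<delta>.\<close>
  define L where "L = 2 * \<kappa> + 1"
  have L: "L \<noteq> 0" "2 * a * \<kappa> + a = a * L" "8 * \<kappa> + 4 = 4 * L" "2 * \<kappa> + 1 = L"
    using \<kappa> by (auto simp: L_def algebra_simps)
  define K where "K = 2 * \<kappa> + 3"
  have K: "K \<noteq> 0" "8 * \<kappa> + 12 = 4 * K" "2 * \<kappa> + 3 = K" using \<kappa> by (auto simp: K_def)
  define n where "n = - f0 + \<sigma> * \<delta> * a * g00"
  have sq: "\<delta> * \<delta> = 1" "\<sigma> * \<sigma> = 1" "\<delta> \<noteq> 0" using \<sigma> \<delta> by auto
  have \<alpha>2': "\<alpha>2 = 2 * n / (a * L)"
    using sq(3) unfolding \<alpha>2 L n_def by (auto simp: divide_simps L a) (simp add: algebra_simps)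
  show "\<alpha>2 = (- 2 * f0 + \<sigma> * 2 * \<delta> * a * g00) / (2 * a * \<kappa> + a)"
    unfolding \<alpha>2' L n_def by (simp add: algebra_simps)
  have \<kappa>_poly: "\<kappa> * (2 * \<kappa> + 3) + 7 = 2 * \<kappa>\<^sup>2 + 3 * \<kappa> + 7"
    by (simp add: algebra_simps power2_eq_square)
  show "(2 * \<kappa>\<^sup>2 + 3 * \<kappa> + 7) / 6 * \<alpha>2 ^ 3 =
      4 * (\<kappa> * (2 * \<kappa> + 3) + 7) * (- f0 + \<sigma> * \<delta> * a * g00) ^ 3 / (3 * a ^ 3 * (2 * \<kappa> + 1) ^ 3)"
    unfolding \<alpha>2' n_def[symmetric] \<kappa>_poly L
    by (simp add: power_divide power_mult_distrib) (simp add: algebra_simps)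
  show "(\<delta> * f1 - \<sigma> * \<delta> * g00 * (\<delta> * f0) + ((\<sigma> * \<delta> * g00)\<^sup>2 - \<sigma> * \<delta> * g10) / 2 * (\<delta> * a)) * \<alpha>2 / (\<delta> * a) =
      \<sigma> * (12 * \<delta> * a * (f0 - \<sigma> * \<delta> * a * g00)
        * (a * (g10 - \<sigma> * \<delta> * g00\<^sup>2) + 2 * f0 * g00 - \<sigma> * 2 * \<delta> * f1) / (3 * a ^ 3 * (8 * \<kappa> + 4)))"
  proof -
    have n: "f0 - \<sigma> * \<delta> * a * g00 = - n" by (simp add: n_def)
    show ?thesis
      unfolding \<alpha>2' L n using \<sigma> \<delta> a L(1)
      by (elim disjE) (simp_all add: field_simps power2_eq_square power3_eq_cube)
  qed
  show "2 * (\<delta> * f2 - \<sigma> * \<delta> * g00 * (\<delta> * f1) + ((\<sigma> * \<delta> * g00)\<^sup>2 - \<sigma> * \<delta> * g10) / 2 * (\<delta> * f0)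
          + (- (\<sigma> * \<delta> * g20) / 3 + \<sigma> * \<delta> * g00 * (\<sigma> * \<delta> * g10) / 2 - (\<sigma> * \<delta> * g00) ^ 3 / 6) * (\<delta> * a))
        / (\<delta> * a * (2 * \<kappa> + 3)) =
      - (\<sigma> * (4 * \<delta> * a\<^sup>2 * (a * (2 * g20 + g00 ^ 3) + 6 * g00 * f1 + 3 * f0 * g10
          - \<sigma> * 3 * \<delta> * (a * g10 * g00 + f0 * g00\<^sup>2 + 2 * f2)) / (3 * a ^ 3 * (8 * \<kappa> + 12))))"
    unfolding K using \<sigma> \<delta> a K(1)
    by (elim disjE) (simp_all add: field_simps power2_eq_square power3_eq_cube)
qed

theorem corollary1:
  fixes Z :: "side \<Rightarrow> real \<times> real \<Rightarrow> real \<times> real"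
    and k :: "side \<Rightarrow> nat"
    and \<delta> :: real
    and \<phi> :: "side \<Rightarrow> real \<Rightarrow> real"
    and \<alpha> F :: "side \<Rightarrow> real fps"
    and G :: "side \<Rightarrow> nat \<Rightarrow> nat \<Rightarrow> real"
  assumes "\<And>s. analytic_field (Z s)"
    and "\<And>s. k s > 0"
    and "monodromic_tangential Z k"
    and "\<delta> = sgn (X_of (Z Upper) 0 0)"
    and "\<And>s. f_expansion s \<delta> (Z s) (k s) (F s)"
    and "\<And>s. g_expansion s \<delta> (Z s) (G s)"
    and "\<And>s. half_return_map s (Z s) (\<phi> s)"
    and "\<And>s. \<phi> s has_fps_expansion \<alpha> s"
  shows "\<forall>s.
    (let \<sigma> = pm s; a = a_of (Z s) (k s); \<kappa> = real (k s); f = fps_nth (F s); g = G s;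
         A = fps_nth (\<alpha> s);
         \<xi> = (if k s = 1 then - (4 * a * g 0 1 / 15) else 0)
     in
       A 1 = -1 \<and>
       A 2 = (- 2 * f 0 + \<sigma> * 2 * \<delta> * a * g 0 0) / (2 * a * \<kappa> + a) \<and>
       A 3 = - (A 2)\<^sup>2 \<and>
       A 4 =
         4 * (\<kappa> * (2 * \<kappa> + 3) + 7) * (- f 0 + \<sigma> * \<delta> * a * g 0 0) ^ 3
           / (3 * a ^ 3 * (2 * \<kappa> + 1) ^ 3)
         - \<sigma> * (12 * \<delta> * a * (f 0 - \<sigma> * \<delta> * a * g 0 0)
               * (a * (g 1 0 - \<sigma> * \<delta> * (g 0 0)\<^sup>2) + 2 * f 0 * g 0 0 - \<sigma> * 2 * \<delta> * f 1)
             / (3 * a ^ 3 * (8 * \<kappa> + 4)))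
         + \<sigma> * (4 * \<delta> * a\<^sup>2
               * (a * (2 * g 2 0 + (g 0 0) ^ 3) + 6 * g 0 0 * f 1 + 3 * f 0 * g 1 0
                  - \<sigma> * 3 * \<delta> * (a * g 1 0 * g 0 0 + f 0 * (g 0 0)\<^sup>2 + 2 * f 2))
             / (3 * a ^ 3 * (8 * \<kappa> + 12)))
         + \<xi>)"
proof
  fix s :: side
  define \<sigma> where "\<sigma> = pm s"
  define a where "a = a_of (Z s) (k s)"
  note mono = assms(3)[unfolded monodromic_tangential_def]
  have X: "X_of (Z s) 0 0 \<noteq> 0" and Y: "Y_of (Z s) 0 0 = 0" for s using mono by auto
  have \<sigma>: "\<sigma> = 1 \<or> \<sigma> = -1" by (simp add: \<sigma>_def pm_cases)
  have \<delta>: "\<delta> = 1 \<or> \<delta> = -1" using X[of Upper] by (auto simp: assms(4) sgn_real_def)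
  have "X_of (Z Upper) 0 0 * X_of (Z Lower) 0 0 < 0" using mono by blast
  \<comment> \<open>X has opposite signs on the two sides, so a single \<delta> serves both.\<close>
  then have sgnX: "sgn (X_of (Z s) 0 0) = \<sigma> * \<delta>"
    unfolding assms(4) \<sigma>_def by (cases s) (auto simp: sgn_real_def mult_less_0_iff)
  have "\<sigma> * (X_of (Z s) 0 0 * dxY (Z s) (2 * k s - 1)) < 0" using mono by (auto simp: \<sigma>_def)
  then have "\<sigma> * (\<sigma> * \<delta> * \<bar>X_of (Z s) 0 0\<bar> * dxY (Z s) (2 * k s - 1)) < 0"
    using mult_sgn_abs[of "X_of (Z s) 0 0"] by (simp add: sgnX)
  then have "\<delta> * dxY (Z s) (2 * k s - 1) * \<bar>X_of (Z s) 0 0\<bar> < 0"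
    using \<sigma> by (elim disjE) (simp_all add: mult_ac)
  then have "\<delta> * dxY (Z s) (2 * k s - 1) < 0"
    by (simp add: mult_less_0_iff)
  \<comment> \<open>Invisibility carries a sign that depends on the side, and so does X; they
    cancel, so this inequality is the same above and below.\<close>
  then have neg: "\<delta> * a < 0"
    unfolding a_def a_of_def times_divide_eq_right using X[of s] by (simp add: divide_less_0_iff)
  note H = half_return_coeffs[OF assms(1)[of s] assms(2)[of s] X Y \<delta> neg[unfolded a_def]
      assms(5)[of s] assms(6)[of s] assms(7)[of s] assms(8)[of s], folded \<sigma>_def a_def]
  have a: "a \<noteq> 0" and \<kappa>: "real (k s) > 0" using neg assms(2) by auto
  note N = normalize_signs[OF \<sigma> \<delta> a \<kappa> H(2)]
  have \<xi>: "- 4 * (\<delta> * G s 0 1) * (\<delta> * a) / 15 = - (4 * a * G s 0 1 / 15)"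
    using \<delta> by auto
  show "let \<sigma> = pm s; a = a_of (Z s) (k s); \<kappa> = real (k s); f = fps_nth (F s); g = G s;
         A = fps_nth (\<alpha> s);
         \<xi> = (if k s = 1 then - (4 * a * g 0 1 / 15) else 0)
     in
       A 1 = -1 \<and>
       A 2 = (- 2 * f 0 + \<sigma> * 2 * \<delta> * a * g 0 0) / (2 * a * \<kappa> + a) \<and>
       A 3 = - (A 2)\<^sup>2 \<and>
       A 4 =
         4 * (\<kappa> * (2 * \<kappa> + 3) + 7) * (- f 0 + \<sigma> * \<delta> * a * g 0 0) ^ 3
           / (3 * a ^ 3 * (2 * \<kappa> + 1) ^ 3)
         - \<sigma> * (12 * \<delta> * a * (f 0 - \<sigma> * \<delta> * a * g 0 0)
               * (a * (g 1 0 - \<sigma> * \<delta> * (g 0 0)\<^sup>2) + 2 * f 0 * g 0 0 - \<sigma> * 2 * \<delta> * f 1)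
             / (3 * a ^ 3 * (8 * \<kappa> + 4)))
         + \<sigma> * (4 * \<delta> * a\<^sup>2
               * (a * (2 * g 2 0 + (g 0 0) ^ 3) + 6 * g 0 0 * f 1 + 3 * f 0 * g 1 0
                  - \<sigma> * 3 * \<delta> * (a * g 1 0 * g 0 0 + f 0 * (g 0 0)\<^sup>2 + 2 * f 2))
             / (3 * a ^ 3 * (8 * \<kappa> + 12)))
         + \<xi>"
    unfolding Let_def \<sigma>_def[symmetric] a_def[symmetric]
  proof (intro conjI)
    show "fps_nth (\<alpha> s) 1 = -1" by (rule H)
    show "fps_nth (\<alpha> s) 3 = - (fps_nth (\<alpha> s) 2)\<^sup>2" by (rule H)
  qed (rule N(1), simp only: H(4)[unfolded \<xi>] N(2-4) diff_minus_eq_add)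
qed

end
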